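(* The bipartite pattern matching problem can be solved in $\mathcal{O}(N+|E|)$ time after preprocessing the pattern $P$ in $\mathcal{O}(m)$ time.
   Context: Bipartite pattern matching: we are given a bipartite graph $G(U,V,E)$, where each node of $U$ and each node of $V$ is labeled by a string, and $E$ is a set of edges $(u,v)$ with $u\in U$, $v\in V$. Let $N_U$ and $N_V$ be the total lengths of the labels in $U$ and in $V$, respectively, and $N=N_U+N_V$. We are also given a pattern string $P$ of length $m$. The alphabet is an integer alphabet of size polynomial in $N$. The problem asks to find every pair $(u,v)\in E$ such that the label of $u$ has a suffix $s$ and the label of $v$ has a prefix $p$ with $P=s\cdot p$ (concatenation). *)

theory Defs
  imports
    Complex_Main
    "HOL-Library.Sublist"
    "HOL-Library.Landau_Symbols"
    "HOL-Computational_Algebra.Polynomial"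
begin

section \<open>Word RAM\<close>

text \<open>
  Algorithms are programs of a word RAM with word length \<open>w\<close>, given as a deeply embedded structured
  language. A machine word is a natural number below \<open>2 ^ w\<close>. The memory consists of named registers
  and named arrays of words; array indices are words. A program is a finite object, so it can only
  mention a fixed number of registers and arrays, and it does not depend on \<open>w\<close>. Every evaluated
  operator, constant, register access, array access and command costs one unit of time.
\<close>

type_synonym name = string

record state =
  reg :: "name \<Rightarrow> nat"
  mem :: "name \<Rightarrow> nat \<Rightarrow> nat"

datatype binop =
    Add | Sub | Mul | Div | Mod
  | Less | Equal
  | BitAnd | BitOr | BitXor | ShiftL | ShiftR

datatype expr =
    Const nat
  | Reg name
  | Load name expr
  | Bin binop expr expr

datatype com =
    Skip
  | Assign name expr
  | Store name expr expr
  | Seq com com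
  | Cond expr com com
  | While expr com

text \<open>\<open>Sub\<close> is truncated subtraction; \<open>Div\<close> and \<open>Mod\<close> by zero yield \<open>0\<close> and the first operand.\<close>

fun binop_val :: "binop \<Rightarrow> nat \<Rightarrow> nat \<Rightarrow> nat" where
  "binop_val Add x y = x + y"
| "binop_val Sub x y = x - y"
| "binop_val Mul x y = x * y"
| "binop_val Div x y = x div y"
| "binop_val Mod x y = x mod y"
| "binop_val Less x y = (if x < y then 1 else 0)"
| "binop_val Equal x y = (if x = y then 1 else 0)"
| "binop_val BitAnd x y = and x y"
| "binop_val BitOr x y = or x y"
| "binop_val BitXor x y = xor x y"
| "binop_val ShiftL x y = push_bit y x"
| "binop_val ShiftR x y = drop_bit y x"

fun eval_expr :: "nat \<Rightarrow> state \<Rightarrow> expr \<Rightarrow> nat" where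
  "eval_expr w s (Const n) = n mod 2 ^ w"
| "eval_expr w s (Reg x) = reg s x"
| "eval_expr w s (Load a e) = mem s a (eval_expr w s e)"
| "eval_expr w s (Bin f e1 e2) = binop_val f (eval_expr w s e1) (eval_expr w s e2) mod 2 ^ w"

fun cost :: "expr \<Rightarrow> nat" where
  "cost (Const n) = 1"
| "cost (Reg x) = 1"
| "cost (Load a e) = 1 + cost e"
| "cost (Bin f e1 e2) = 1 + cost e1 + cost e2"

text \<open>\<open>exec w c s t s'\<close>: started in \<open>s\<close>, the program \<open>c\<close> terminates in \<open>s'\<close> after exactly \<open>t\<close> time units.\<close>

inductive exec :: "nat \<Rightarrow> com \<Rightarrow> state \<Rightarrow> nat \<Rightarrow> state \<Rightarrow> bool" for w :: nat where
  Skip: "exec w Skip s 1 s"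
| Assign: "exec w (Assign x e) s (1 + cost e) (s\<lparr>reg := (reg s)(x := eval_expr w s e)\<rparr>)"
| Store: "exec w (Store a e1 e2) s (1 + cost e1 + cost e2)
    (s\<lparr>mem := (mem s)(a := (mem s a)(eval_expr w s e1 := eval_expr w s e2))\<rparr>)"
| Seq: "exec w c1 s1 t1 s2 \<Longrightarrow> exec w c2 s2 t2 s3 \<Longrightarrow> exec w (Seq c1 c2) s1 (t1 + t2) s3"
| CondTrue: "eval_expr w s b \<noteq> 0 \<Longrightarrow> exec w c1 s t s' \<Longrightarrow>
    exec w (Cond b c1 c2) s (1 + cost b + t) s'"
| CondFalse: "eval_expr w s b = 0 \<Longrightarrow> exec w c2 s t s' \<Longrightarrow>
    exec w (Cond b c1 c2) s (1 + cost b + t) s'"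
| WhileFalse: "eval_expr w s b = 0 \<Longrightarrow> exec w (While b c) s (1 + cost b) s"
| WhileTrue: "eval_expr w s1 b \<noteq> 0 \<Longrightarrow> exec w c s1 t1 s2 \<Longrightarrow> exec w (While b c) s2 t2 s3 \<Longrightarrow>
    exec w (While b c) s1 (1 + cost b + t1 + t2) s3"

inductive_cases exec_SkipE: "exec w Skip s t s'"
inductive_cases exec_AssignE: "exec w (Assign x e) s t s'"
inductive_cases exec_StoreE: "exec w (Store a e1 e2) s t s'"
inductive_cases exec_SeqE: "exec w (Seq c1 c2) s t s'"
inductive_cases exec_CondE: "exec w (Cond b c1 c2) s t s'"
inductive_cases exec_WhileE: "exec w (While b c) s t s'"

lemma exec_deterministic:
  "exec w c s t s' \<Longrightarrow> exec w c s u s'' \<Longrightarrow> u = t \<and> s'' = s'"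
proof (induction arbitrary: u s'' rule: exec.induct)
  case (Skip s)
  then show ?case by (rule exec_SkipE) simp
next
  case (Assign x e s)
  then show ?case by (rule exec_AssignE) simp
next
  case (Store a e1 e2 s)
  then show ?case by (rule exec_StoreE) simp
next
  case (Seq c1 s1 t1 s2 c2 t2 s3)
  from Seq.prems obtain u1 r u2
    where "exec w c1 s1 u1 r" "exec w c2 r u2 s''" "u = u1 + u2"
    by (rule exec_SeqE)
  with Seq.IH show ?case by metis
next
  case (CondTrue s b c1 t s' c2)
  from CondTrue.prems CondTrue.hyps obtain v
    where "exec w c1 s v s''" "u = 1 + cost b + v"
    by (auto elim: exec_CondE)
  with CondTrue.IH show ?case by metis
next
  case (CondFalse s b c2 t s' c1)
  from CondFalse.prems CondFalse.hyps obtain v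
    where "exec w c2 s v s''" "u = 1 + cost b + v"
    by (auto elim: exec_CondE)
  with CondFalse.IH show ?case by metis
next
  case (WhileFalse s b c)
  from WhileFalse.prems show ?case
    by (rule exec_WhileE) (use WhileFalse.hyps in simp_all)
next
  case (WhileTrue s1 b c t1 s2 t2 s3)
  from WhileTrue.prems obtain u1 r u2
    where "exec w c s1 u1 r" "exec w (While b c) r u2 s''" "u = 1 + cost b + u1 + u2"
    by (rule exec_WhileE) (use WhileTrue.hyps in simp_all)
  with WhileTrue.IH show ?case by metis
qed


section \<open>Bipartite pattern matching\<close>

text \<open>
  The nodes on each side are numbered \<open>0, 1, \<dots>\<close>; node \<open>u\<close> in \<open>U\<close> has label \<open>U_labels G ! u\<close>, and
  likewise for \<open>V\<close>. Labels may be empty or coincide.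
\<close>

record bigraph =
  U_labels :: "nat list list"
  V_labels :: "nat list list"
  edges :: "(nat \<times> nat) set"

definition wf_bigraph :: "bigraph \<Rightarrow> bool" where
  "wf_bigraph G \<longleftrightarrow> edges G \<subseteq> {..<length (U_labels G)} \<times> {..<length (V_labels G)}"

definition N_U :: "bigraph \<Rightarrow> nat" where
  "N_U G = (\<Sum>x\<leftarrow>U_labels G. length x)"

definition N_V :: "bigraph \<Rightarrow> nat" where
  "N_V G = (\<Sum>x\<leftarrow>V_labels G. length x)"

definition label_size :: "bigraph \<Rightarrow> nat" where
  "label_size G = N_U G + N_V G"

definition letters :: "bigraph \<Rightarrow> nat set" where
  "letters G = \<Union> (set ` (set (U_labels G) \<union> set (V_labels G)))"

definition matching_pairs :: "nat list \<Rightarrow> bigraph \<Rightarrow> (nat \<times> nat) set" where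
  "matching_pairs P G = {(u, v) \<in> edges G.
     \<exists>s p. suffix s (U_labels G ! u) \<and> prefix p (V_labels G ! v) \<and> P = s @ p}"


section \<open>Input and output conventions\<close>

definition init_state :: state where
  "init_state = \<lparr>reg = (\<lambda>_. 0), mem = (\<lambda>_ _. 0)\<rparr>"

definition set_reg :: "name \<Rightarrow> nat \<Rightarrow> state \<Rightarrow> state" where
  "set_reg x n s = s\<lparr>reg := (reg s)(x := n)\<rparr>"

definition set_array :: "name \<Rightarrow> nat list \<Rightarrow> state \<Rightarrow> state" where
  "set_array a xs s =
     s\<lparr>mem := (mem s)(a := (\<lambda>i. if i < length xs then xs ! i else mem s a i))\<rparr>"

definition load_pattern :: "nat list \<Rightarrow> state \<Rightarrow> state" where
  "load_pattern P s = set_reg ''m'' (length P) (set_array ''P'' P s)"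

text \<open>Start positions of the labels in their concatenation, followed by the total length.\<close>

definition offsets :: "nat list list \<Rightarrow> nat list" where
  "offsets xss = map (\<lambda>i. length (concat (take i xss))) [0..<length xss + 1]"

text \<open>
  The labels of each side are stored concatenated, together with their offsets. The edge set is
  passed as a list \<open>es\<close> of its elements in some order.
\<close>

definition load_graph :: "bigraph \<Rightarrow> (nat \<times> nat) list \<Rightarrow> state \<Rightarrow> state" where
  "load_graph G es s =
     (set_reg ''U_count'' (length (U_labels G)) \<circ>
      set_array ''U_text'' (concat (U_labels G)) \<circ>
      set_array ''U_offset'' (offsets (U_labels G)) \<circ>
      set_reg ''V_count'' (length (V_labels G)) \<circ>
      set_array ''V_text'' (concat (V_labels G)) \<circ>
      set_array ''V_offset'' (offsets (V_labels G)) \<circ>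
      set_reg ''E_count'' (length es) \<circ>
      set_array ''E_fst'' (map fst es) \<circ>
      set_array ''E_snd'' (map snd es)) s"

definition reported_pairs :: "state \<Rightarrow> (nat \<times> nat) list" where
  "reported_pairs s = map (\<lambda>i. (mem s ''out_fst'' i, mem s ''out_snd'' i)) [0..<reg s ''out_count'']"

text \<open>
  The word RAM assumption is that a word can hold every letter and a number linear in the size of
  the data at hand. The number of nodes is counted separately because nodes with empty labels do not
  contribute to \<open>label_size\<close>.
\<close>

definition instance_size :: "nat list \<Rightarrow> bigraph \<Rightarrow> nat" where
  "instance_size P G = length P + label_size G +
     length (U_labels G) + length (V_labels G) + card (edges G)"

end

theory Submission
  imports Defs
begin

text \<open>
  Let \<open>m\<close> be the length of \<open>P\<close>. An edge \<open>(u, v)\<close> matches if for some \<open>i\<close> the prefix of \<open>P\<close> of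
  length \<open>i\<close> is a suffix of the label of \<open>u\<close> and the remaining suffix of \<open>P\<close> is a prefix of the
  label of \<open>v\<close>. Up to reversal, \<open>m \<le> 2 i\<close>. Then periodicity leaves only three candidates for \<open>i\<close>:
  the longest prefix of \<open>P\<close> that ends the label of \<open>u\<close>, the longest border of that prefix, and
  \<open>e - d\<close>, where \<open>e\<close> and \<open>d\<close> are the ends of the longest prefixes of \<open>P\<close> and of the label of \<open>v\<close>
  whose period is the least period of the first half of \<open>P\<close>. Hence every edge takes constant time
  once its endpoints have been visited. A visit runs Knuth-Morris-Pratt on the label and walks down
  the failure links to mark all overlaps, which takes time linear in the label. Since the number of
  nodes is not bounded by the total length of the labels, nodes are visited only when an edge
  reaches them.
\<close>

section \<open>Splits of a pattern\<close>

text \<open>The pattern may be much longer than a label, so apart from preprocessing no cost may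
  depend on \<open>m\<close>, and the data of an edge must be computed per endpoint, not per pair.
  Two of the candidates depend on \<open>u\<close> alone. The third separates as well: the period
  and \<open>e\<close> belong to \<open>P\<close>, and \<open>d\<close> belongs to \<open>v\<close>.
  With the mirrored case this gives six candidates per edge.

  Candidates need to be complete, not correct, because each is verified by two lookups. All overlaps
  of a visited label are stamped with the number of its node, plus one, in a block of cells private
  to that node. Failure links strictly shorten an overlap, so the label length pays for the
  stamping. Since a stamp identifies its owner, neither bounds checks nor a clearing pass over all
  nodes is needed.

  Time is amortised twice: inside a scan against the current overlap, and over all edges against the
  total length of the visited labels.\<close>

definition overlap :: "'a list \<Rightarrow> 'a list \<Rightarrow> nat \<Rightarrow> bool" where
  "overlap P x j \<longleftrightarrow> j \<le> length P \<and> suffix (take j P) x"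

definition max_overlap :: "'a list \<Rightarrow> 'a list \<Rightarrow> nat" where
  "max_overlap P x = Max {j. overlap P x j}"

text \<open>Dropping the first letter rules out the trivial overlap \<open>j\<close>, so this is the
  longest proper border of the prefix. It also makes the failure table the outcome of scanning
  \<open>tl P\<close> against \<open>P\<close>.\<close>

definition fail :: "'a list \<Rightarrow> nat \<Rightarrow> nat" where
  "fail P j = max_overlap P (tl (take j P))"

definition has_period :: "nat \<Rightarrow> 'a list \<Rightarrow> bool" where
  "has_period r x \<longleftrightarrow> (\<forall>k. k + r < length x \<longrightarrow> x ! k = x ! (k + r))"

text \<open>The search starts at \<open>q\<close>, so a list shorter than \<open>q\<close> gets the
  value \<open>q\<close>, beyond its end. This is harmless, since the value only enters a candidate
  that is verified afterwards.\<close>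

definition period_end :: "nat \<Rightarrow> 'a list \<Rightarrow> nat" where
  "period_end q x = (LEAST r. q \<le> r \<and> (r < length x \<longrightarrow> x ! r \<noteq> x ! (r - q)))"

section \<open>Overlaps, borders and the failure function\<close>

lemma overlap_0 [simp]: "overlap P x 0"
  by (simp add: overlap_def)

lemma overlap_le: "overlap P x j \<Longrightarrow> j \<le> length P \<and> j \<le> length x"
  by (auto simp: overlap_def dest: suffix_length_le)

lemma finite_overlap: "finite {j. overlap P x j}"
  by (rule finite_subset[of _ "{..length P}"]) (auto dest: overlap_le)

lemma overlap_max_overlap: "overlap P x (max_overlap P x)"
  using Max_in[OF finite_overlap, of P x] overlap_0[of P x] unfolding max_overlap_def by blast

lemma max_overlap_ge: "overlap P x j \<Longrightarrow> j \<le> max_overlap P x"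
  unfolding max_overlap_def by (simp add: finite_overlap)

lemma max_overlap_eqI: "overlap P x j \<Longrightarrow> (\<And>i. overlap P x i \<Longrightarrow> i \<le> j) \<Longrightarrow> max_overlap P x = j"
  by (meson overlap_max_overlap max_overlap_ge antisym)

lemma max_overlap_le: "max_overlap P x \<le> length P" "max_overlap P x \<le> length x"
  using overlap_le[OF overlap_max_overlap] by auto

lemma max_overlap_Nil [simp]: "max_overlap P [] = 0"
  using max_overlap_le(2)[of P "[]"] by simp

text \<open>Of two suffixes of one list, the shorter is a suffix of the longer.\<close>

lemma overlap_overlap:
  assumes "overlap P x j" "i \<le> j"
  shows "overlap P x i \<longleftrightarrow> overlap P (take j P) i"
proof -
  have "j \<le> length P" using assms overlap_le by blast
  then show ?thesis
    using assms unfolding overlap_def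
    by (auto intro: suffix_length_suffix suffix_order.trans)
qed

lemma overlap_snoc:
  "overlap P (x @ [c]) (Suc j) \<longleftrightarrow> j < length P \<and> P ! j = c \<and> overlap P x j"
  by (auto simp: overlap_def take_Suc_conv_app_nth)

lemma overlap_tl: "i < j \<Longrightarrow> j \<le> length P \<Longrightarrow> overlap P (tl (take j P)) i \<longleftrightarrow> overlap P (take j P) i"
proof -
  assume "i < j" "j \<le> length P"
  then obtain a y where y: "take j P = a # y"
    by (cases "take j P") auto
  have "length (a # y) = j" using \<open>j \<le> length P\<close> unfolding y[symmetric] by simp
  with y have y: "take j P = a # y" "length y = j - 1" by auto
  have "length (take i P) < length (a # y)" using \<open>i < j\<close> \<open>j \<le> length P\<close> y by simp
  then have "take i P \<noteq> a # y" by (metis less_irrefl)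
  then show ?thesis using y by (simp add: overlap_def suffix_Cons)
qed

lemma fail_0 [simp]: "fail P 0 = 0"
  by (simp add: fail_def)

lemma fail_1 [simp]: "fail P (Suc 0) = 0"
  by (cases P) (simp_all add: fail_def)

lemma fail_less: "0 < j \<Longrightarrow> j \<le> length P \<Longrightarrow> fail P j < j"
  using max_overlap_le(2)[of P "tl (take j P)"] by (auto simp: fail_def)

lemma fail_le: "j \<le> length P \<Longrightarrow> fail P j \<le> j"
  using fail_less[of j P] by (cases "j = 0") auto

lemma overlap_fail: "0 < j \<Longrightarrow> j \<le> length P \<Longrightarrow> overlap P (take j P) (fail P j)"
  using overlap_tl[OF fail_less] overlap_max_overlap by (metis fail_def)

lemma fail_ge: "i < j \<Longrightarrow> j \<le> length P \<Longrightarrow> overlap P (take j P) i \<Longrightarrow> i \<le> fail P j"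
  unfolding fail_def by (rule max_overlap_ge) (simp add: overlap_tl)

lemma overlap_fail_trans:
  assumes "overlap P x j" shows "overlap P x (fail P j)"
proof (cases "j = 0")
  case False
  then show ?thesis
    using assms overlap_fail[of j P] fail_le[of j P] overlap_le[OF assms] overlap_overlap[OF assms, of "fail P j"] by auto
qed simp

text \<open>Together with \<open>overlap_fail_trans\<close>: following failure links from the
  longest overlap meets every overlap and skips none. Both the scan and the stamping rest on
  this.\<close>

lemma overlap_less_fail:
  assumes "overlap P x j" "overlap P x i" "i < j" shows "i \<le> fail P j"
  using assms fail_ge overlap_overlap[of P x j i] overlap_le by (metis less_imp_le)

text \<open>Nonempty overlaps of \<open>x @ [c]\<close> are one-letter extensions of overlaps of
  \<open>x\<close>. The last hypothesis is what the scan knows when it stops: all longer overlaps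
  have failed.\<close>

lemma max_overlap_snoc_hit:
  assumes "overlap P x j" "j < length P" "P ! j = c"
    and "\<And>i. overlap P x i \<Longrightarrow> j < i \<Longrightarrow> \<not> (i < length P \<and> P ! i = c)"
  shows "max_overlap P (x @ [c]) = Suc j"
proof (rule max_overlap_eqI)
  show "overlap P (x @ [c]) (Suc j)" using assms by (simp add: overlap_snoc)
  fix i assume "overlap P (x @ [c]) i"
  then show "i \<le> Suc j"
    using assms(4)[of "i - 1"] by (cases i; cases "j < i - 1") (auto simp: overlap_snoc)
qed

lemma max_overlap_snoc_miss:
  assumes "\<And>i. overlap P x i \<Longrightarrow> \<not> (i < length P \<and> P ! i = c)"
  shows "max_overlap P (x @ [c]) = 0"
proof (rule max_overlap_eqI)
  show "overlap P (x @ [c]) 0" by simp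
  fix i assume "overlap P (x @ [c]) i"
  then show "i \<le> 0" using assms by (cases i) (auto simp: overlap_snoc)
qed

section \<open>Periods of prefixes\<close>

lemma period_end_bounds: "q \<le> period_end q x" "period_end q x \<le> max q (length x)"
  "period_end q x < length x \<Longrightarrow> x ! period_end q x \<noteq> x ! (period_end q x - q)"
proof -
  let ?Q = "\<lambda>r. q \<le> r \<and> (r < length x \<longrightarrow> x ! r \<noteq> x ! (r - q))"
  have Q: "?Q (max q (length x))" by simp
  have "?Q (period_end q x)" unfolding period_end_def by (rule LeastI) (rule Q)
  then show "q \<le> period_end q x" "period_end q x < length x \<Longrightarrow> x ! period_end q x \<noteq> x ! (period_end q x - q)" by auto
  show "period_end q x \<le> max q (length x)" unfolding period_end_def by (rule Least_le) (rule Q)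
qed

lemma period_end_eqI:
  assumes "q \<le> r" "r < length x \<Longrightarrow> x ! r \<noteq> x ! (r - q)"
    and "\<And>k. q \<le> k \<Longrightarrow> k < r \<Longrightarrow> k < length x \<and> x ! k = x ! (k - q)"
  shows "period_end q x = r"
  unfolding period_end_def
  by (rule Least_equality) (use assms in \<open>auto simp: not_less[symmetric]\<close>)

lemma period_end_below: "q \<le> k \<Longrightarrow> k < period_end q x \<Longrightarrow> k < length x \<and> x ! k = x ! (k - q)"
  unfolding period_end_def by (drule not_less_Least) auto

lemma overlap_iff_nth:
  "overlap P (take a P) i \<longleftrightarrow> (\<forall>k<i. P ! k = P ! (k + (a - i)))" if "i \<le> a" "a \<le> length P"
proof -
  have "overlap P (take a P) i \<longleftrightarrow> take i P = drop (a - i) (take a P)"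
  proof
    assume "overlap P (take a P) i"
    then obtain zs where zs: "take a P = zs @ take i P" by (auto simp: overlap_def suffix_def)
    then have "length zs = a - i" using that by (metis add_diff_cancel_right' length_append length_take min.absorb2 order.trans)
    then show "take i P = drop (a - i) (take a P)" unfolding zs by simp
  next
    assume "take i P = drop (a - i) (take a P)"
    then show "overlap P (take a P) i"
      using that suffix_drop[of "a - i" "take a P"] by (simp add: overlap_def)
  qed
  also have "\<dots> \<longleftrightarrow> (\<forall>k<i. P ! k = P ! (k + (a - i)))"
    using that by (auto simp: list_eq_iff_nth_eq add.commute)
  finally show ?thesis .
qed

text \<open>Border-period duality: a prefix shifted by \<open>r\<close> against itself agrees on a
  stretch of length \<open>a - r\<close>, which is a border.\<close>

lemma period_iff_overlap:
  assumes "r \<le> a" "a \<le> length P"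
  shows "has_period r (take a P) \<longleftrightarrow> overlap P (take a P) (a - r)"
  using assms by (auto simp: overlap_iff_nth has_period_def)

lemma period_take: "has_period r x \<Longrightarrow> has_period r (take n x)"
  by (auto simp: has_period_def)

text \<open>Go forward by \<open>r\<close> and back by \<open>p\<close> if \<open>k + r\<close> is
  in range. Otherwise go back by \<open>p\<close> first; the length bound then ensures
  \<open>p \<le> k\<close>.\<close>

lemma period_diff:
  assumes "has_period p x" "has_period r x" "p \<le> r" "p + r \<le> length x"
  shows "has_period (r - p) x"
  unfolding has_period_def
proof (intro allI impI)
  fix k assume k: "k + (r - p) < length x"
  show "x ! k = x ! (k + (r - p))"
  proof (cases "k + r < length x")
    case True
    then have "x ! k = x ! (k + r)" using assms by (auto simp: has_period_def)
    moreover have "x ! (k + (r - p)) = x ! (k + (r - p) + p)"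
      using assms True k by (auto simp: has_period_def)
    ultimately show ?thesis using assms by simp
  next
    case False
    then have "p \<le> k" using assms by simp
    have "x ! (k - p) = x ! (k - p + p)"
      using assms(1) k \<open>p \<le> k\<close> by (auto simp: has_period_def)
    moreover have "x ! (k - p) = x ! (k - p + r)"
      using assms(2,3) k \<open>p \<le> k\<close> by (auto simp: has_period_def)
    ultimately show ?thesis using \<open>p \<le> k\<close> assms(3) by (simp add: add.commute)
  qed
qed

text \<open>The weak periodicity lemma of Fine and Wilf, for a least period \<open>q\<close>.\<close>

lemma least_period_dvd:
  assumes "0 < q" "has_period q x" "\<And>r. 0 < r \<Longrightarrow> has_period r x \<Longrightarrow> q \<le> r" "has_period r x" "q + r \<le> length x"
  shows "q dvd r"
  using assms(4,5)
proof (induction r rule: less_induct)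
  case (less r)
  show ?case
  proof (cases "r = 0")
    case False
    then have "q \<le> r" using assms(3) less by simp
    \<comment> \<open>Euclid by subtraction: \<open>r - q\<close> is again a period, with a weaker
      length condition.\<close>
    moreover have "has_period (r - q) x" using period_diff less assms \<open>q \<le> r\<close> by blast
    ultimately have "q dvd r - q" using less False assms(1) by simp
    then show ?thesis using \<open>q \<le> r\<close> by (metis dvd_minus_self less_le_not_le)
  qed simp
qed

lemma period_mult:
  assumes "has_period q x" "k + n * q < length x" shows "x ! k = x ! (k + n * q)"
  using assms(2)
proof (induction n)
  case (Suc n)
  have "x ! (k + n * q) = x ! (k + n * q + q)" using Suc.prems assms(1) by (auto simp: has_period_def algebra_simps)
  then show ?case using Suc by (simp add: algebra_simps)
qed simp

text \<open>Positions from \<open>r\<close> on are moved back by the period \<open>r\<close> of the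
  whole list, inductively. Positions below \<open>r\<close> compare letters inside the prefix of
  length \<open>h\<close>, as \<open>r + q \<le> h\<close>.\<close>

lemma period_extend:
  assumes "has_period r x" "has_period q (take h x)" "q dvd r" "0 < r" "r + q \<le> h" "h \<le> length x"
  shows "has_period q x"
  unfolding has_period_def
proof (intro allI impI)
  fix k assume "k + q < length x"
  then show "x ! k = x ! (k + q)"
  proof (induction k rule: less_induct)
    case (less k)
    show ?case
    proof (cases "r \<le> k")
      case True
      then have "x ! (k - r) = x ! k" "x ! (k - r + q) = x ! (k + q)"
        using assms(1) less.prems by (auto simp: has_period_def dest!: spec[of _ "k - r"] spec[of _ "k - r + q"])
      then show ?thesis using less.IH[of "k - r"] less.prems True \<open>0 < r\<close> by simp
    next
      case False
      then show ?thesis using assms by (auto simp: has_period_def)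
    qed
  qed
qed

lemma period_period_end_take: "has_period q (take (period_end q x) x)"
  unfolding has_period_def
proof (intro allI impI)
  fix k assume "k + q < length (take (period_end q x) x)"
  then show "take (period_end q x) x ! k = take (period_end q x) x ! (k + q)"
    using period_end_below[of q "k + q" x] by simp
qed

lemma period_end_ge_period:
  assumes "has_period q (take a x)" "a \<le> length x"
  shows "a \<le> period_end q x"
proof (rule ccontr)
  assume "\<not> ?thesis"
  then have lt: "period_end q x < a" "period_end q x < length x" using assms(2) by auto
  have "q \<le> period_end q x" "x ! period_end q x \<noteq> x ! (period_end q x - q)"
    using period_end_bounds(1) period_end_bounds(3)[OF lt(2)] by auto
  then show False
    using assms lt by (auto simp: has_period_def dest!: spec[of _ "period_end q x - q"])
qed

text \<open>
  A match at a split point that is neither of the two longest borders forces a short period \<open>q\<close> on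
  the first half of \<open>P\<close>. The split is then determined by aligning the ends of the \<open>q\<close>-periodic
  prefixes of \<open>P\<close> and of \<open>y\<close>, or can be shifted to the longest border if \<open>P\<close> is \<open>q\<close>-periodic.
\<close>

lemma split_candidates:
  fixes P x y :: "'a list"
  defines "a \<equiv> max_overlap P x" and "h \<equiv> (length P + 1) div 2"
  defines "q \<equiv> h - fail P h"
  assumes i: "overlap P x i" "prefix (drop i P) y" "length P \<le> 2 * i"
  shows "\<exists>i' \<in> {a, fail P a, period_end q P - period_end q y}. overlap P x i' \<and> prefix (drop i' P) y"
proof (cases "i = a \<or> i = fail P a")
  case True
  then show ?thesis using i by blast
next
  case False
  let ?m = "length P"
  define f where "f = fail P a"
  have pa: "overlap P x a" by (simp add: a_def overlap_max_overlap)
  have am: "a \<le> ?m" using pa overlap_le by blast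
  have ia: "i < a" using max_overlap_ge[OF i(1)] False by (simp add: a_def)
  have "i < f" using overlap_less_fail[OF pa i(1) ia] False by (simp add: f_def)
  have fa: "f < a" using fail_less[of a P] am ia by (simp add: f_def)
  have hi: "h \<le> i" using i(3) by (simp add: h_def)
  have hm: "h \<le> ?m" using hi ia am by simp
  have hp: "0 < h" using ia am by (simp add: h_def)
  \<comment> \<open>The overlaps \<open>i < f < a\<close> have gaps \<open>r\<close> and
    \<open>s\<close>, which become periods of \<open>take a P\<close> and
    \<open>take f P\<close>.\<close>
  define r where "r = a - f"
  define s where "s = f - i"
  \<comment> \<open>The gaps sum to \<open>a - i\<close>, at most half the pattern because
    \<open>i\<close> lies in the upper half. This is the room that the periodicity lemma needs on
    the first half.\<close>
  have rs: "0 < r" "0 < s" "r + s \<le> h" "i = a - (r + s)"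
    using \<open>i < f\<close> fa am i(3) by (auto simp: r_def s_def h_def)
  have pf: "overlap P (take a P) f" using overlap_fail[of a P] ia am by (simp add: f_def)
  have r_a: "has_period r (take a P)"
    using pf fa am period_iff_overlap[of r a P] by (simp add: r_def)
  have "overlap P x f" using overlap_fail_trans[OF pa] by (simp add: f_def)
  then have "overlap P (take f P) i" using overlap_overlap i(1) \<open>i < f\<close> by (metis less_imp_le)
  then have s_f: "has_period s (take f P)"
    using period_iff_overlap[of s f P] \<open>i < f\<close> fa am by (simp add: s_def)
  let ?H = "take h P"
  have r_h: "has_period r ?H" using period_take[OF r_a, of h] hi ia by (simp add: min_absorb1)
  have s_h: "has_period s ?H" using period_take[OF s_f, of h] hi \<open>i < f\<close> by (simp add: min_absorb1)
  have q0: "0 < q" using fail_less[OF hp hm] by (simp add: q_def)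
  have qh: "q \<le> h" by (simp add: q_def)
  have q_h: "has_period q ?H"
    using period_iff_overlap[OF qh hm] overlap_fail[OF hp hm] fail_le[OF hm] by (simp add: q_def)
  \<comment> \<open>\<open>fail P h\<close> is the longest proper border of \<open>?H\<close>, so by
    duality \<open>q\<close> is its least positive period.\<close>
  have q_least: "q \<le> p" if "0 < p" "has_period p ?H" for p
  proof (cases "p \<le> h")
    case True
    then have "h - p \<le> fail P h"
      using fail_ge[of "h - p" h P] period_iff_overlap[OF True hm] that hp hm by auto
    then show ?thesis by (simp add: q_def)
  qed (use qh in simp)
  have "q \<le> r" "q \<le> s" using q_least r_h s_h rs by auto
  have qi: "i + q \<le> a" using \<open>q \<le> s\<close> \<open>i < f\<close> fa by (simp add: s_def)
  have qr: "q dvd r" "q dvd s"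
    using least_period_dvd[OF q0 q_h q_least] r_h s_h \<open>q \<le> r\<close> \<open>q \<le> s\<close> rs hm by auto
  \<comment> \<open>\<open>q \<le> s\<close> gives \<open>r + q \<le> h\<close>, so the period of
    the first half carries over to the prefix of length \<open>a\<close>.\<close>
  have q_a: "has_period q (take a P)"
    by (rule period_extend[OF r_a _ qr(1), of h])
      (use q_h rs \<open>q \<le> s\<close> hi ia am in \<open>auto simp: min_absorb1\<close>)
  define e where "e = period_end q P"
  have ae: "a \<le> e" using period_end_ge_period[OF q_a am] by (simp add: e_def)
  have em: "e \<le> ?m" using period_end_bounds(2)[of q P] qh hm by (simp add: e_def)
  have q_e: "has_period q (take e P)" using period_period_end_take by (simp add: e_def)
  \<comment> \<open>The shift from \<open>i\<close> to \<open>a\<close> is a multiple of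
    \<open>q\<close>, hence invisible inside the periodic part.\<close>
  obtain n where n: "r + s = n * q" using qr by (metis dvd_add dvdE mult.commute)
  have ii: "i + n * q = a" using n rs hi ia by simp
  obtain z where z: "y = drop i P @ z" using i(2) by (auto simp: prefix_def)
  show ?thesis
  proof (cases "e = ?m")
    case True
    \<comment> \<open>If all of \<open>P\<close> has period \<open>q\<close>, the remainder after
      \<open>a\<close> repeats the beginning of the remainder after \<open>i\<close>, so
      \<open>a\<close> is a valid split too.\<close>
    have "drop a P = take (?m - a) (drop i P)"
    proof (rule nth_equalityI)
      fix k assume k: "k < length (drop a P)"
      have "P ! (i + k) = P ! (i + k + n * q)"
        by (rule period_mult) (use q_e True k ii in auto)
      moreover have "i + k + n * q = a + k" using ii by simp
      ultimately show "drop a P ! k = take (?m - a) (drop i P) ! k"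
        using k ia am by simp
    qed (use ia am in auto)
    then have "prefix (drop a P) y" using z by (metis prefix_def append.assoc append_take_drop_id)
    then show ?thesis using pa by blast
  next
    case False
    \<comment> \<open>\<open>y\<close> begins with \<open>drop i P\<close>, so the mismatch of
      \<open>P\<close> at \<open>e\<close> reappears in \<open>y\<close> at \<open>e - i\<close>.
      Its partner \<open>e - i - q\<close> is a position of \<open>y\<close> because
      \<open>i + q \<le> a \<le> e\<close>.\<close>
    have "period_end q y = e - i"
    proof (rule period_end_eqI)
      show "q \<le> e - i" using qi ae by simp
      have "P ! e \<noteq> P ! (e - q)" using period_end_bounds(3)[of q P] False em by (simp add: e_def)
      moreover have "y ! (e - i) = P ! e" "y ! (e - i - q) = P ! (e - q)"
        using z False em ae ia qi by (auto simp: nth_append)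
      ultimately show "y ! (e - i) \<noteq> y ! (e - i - q)" by simp
    next
      fix k assume k: "q \<le> k" "k < e - i"
      have "P ! (i + k) = P ! (i + k - q)"
        using period_end_below[of q "i + k" P] k by (simp add: e_def)
      then show "k < length y \<and> y ! k = y ! (k - q)"
        using z k em by (auto simp: nth_append)
    qed
    then have "period_end q P - period_end q y = i" using ae ia by (simp add: e_def)
    then show ?thesis using i by blast
  qed
qed

section \<open>Both halves of the pattern, by reversal\<close>

lemma overlap_rev_iff:
  "i \<le> length P \<Longrightarrow> overlap (rev P) (rev y) (length P - i) \<longleftrightarrow> prefix (drop i P) y"
  by (simp add: overlap_def take_rev suffix_to_prefix)

text \<open>\<open>z\<close> stands for the reversed label of the right node: both conditions become
  overlaps, so both sides can share one program.\<close>

definition split_at :: "'a list \<Rightarrow> 'a list \<Rightarrow> 'a list \<Rightarrow> nat \<Rightarrow> bool" where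
  "split_at P x z i \<longleftrightarrow> overlap P x i \<and> overlap (rev P) z (length P - i)"

text \<open>For a nonempty pattern this is the least period of its first half, rounded up, by
  border-period duality.\<close>

definition half_period :: "'a list \<Rightarrow> nat" where
  "half_period P = (length P + 1) div 2 - fail P ((length P + 1) div 2)"

text \<open>Members need not be splits; \<open>cands_le\<close> is all that is guaranteed.
  \<open>rev z\<close> is the right label in its original order.\<close>

definition cands :: "'a list \<Rightarrow> 'a list \<Rightarrow> 'a list \<Rightarrow> nat set" where
  "cands P x z = {max_overlap P x, fail P (max_overlap P x), period_end (half_period P) P - period_end (half_period P) (rev z)}"

lemma half_period_le: "half_period P \<le> length P"
  by (cases P) (auto simp: half_period_def)

lemma period_end_half_period_le: "period_end (half_period P) P \<le> length P"
  using period_end_bounds(2)[of "half_period P" P] half_period_le[of P] by simp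

lemma cands_le: "i \<in> cands P x z \<Longrightarrow> i \<le> length P"
  using period_end_half_period_le[of P] max_overlap_le(1)[of P x] fail_le[of "max_overlap P x" P]
  by (auto simp: cands_def)

lemma split_at_swap:
  "i \<le> length P \<Longrightarrow> split_at P x z i \<longleftrightarrow> split_at (rev P) z x (length P - i)"
  by (auto simp: split_at_def)

lemma split_at_upper_half:
  assumes "split_at P x z i" "length P \<le> 2 * i"
  shows "\<exists>i' \<in> cands P x z. split_at P x z i'"
proof -
  have i: "overlap P x i" "i \<le> length P" using assms overlap_le by (auto simp: split_at_def)
  then have "prefix (drop i P) (rev z)"
    using assms overlap_rev_iff[of i P "rev z"] by (simp add: split_at_def)
  from split_candidates[OF i(1) this assms(2)] obtain i'
    where "i' \<in> cands P x z" "overlap P x i'" "prefix (drop i' P) (rev z)"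
    unfolding cands_def half_period_def by blast
  moreover from this have "i' \<le> length P" using overlap_le by blast
  ultimately show ?thesis
    using overlap_rev_iff[of i' P "rev z"] by (auto simp: split_at_def)
qed

text \<open>One of \<open>i\<close> and \<open>length P - i\<close> is at least half the length, so
  one of the two orientations applies.\<close>

lemma split_at_iff_cands:
  "(\<exists>i \<le> length P. split_at P x z i) \<longleftrightarrow>
    (\<exists>i \<in> cands P x z. split_at P x z i) \<or>
    (\<exists>j \<in> cands (rev P) z x. split_at P x z (length P - j))"
proof
  assume "\<exists>i \<le> length P. split_at P x z i"
  then obtain i where i: "i \<le> length P" "split_at P x z i" by blast
  show "(\<exists>i \<in> cands P x z. split_at P x z i) \<or>
    (\<exists>j \<in> cands (rev P) z x. split_at P x z (length P - j))"
  proof (cases "length P \<le> 2 * i")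
    case True
    then show ?thesis using split_at_upper_half i by blast
  next
    case False
    have "split_at (rev P) z x (length P - i)" using split_at_swap i by blast
    moreover have "length (rev P) \<le> 2 * (length P - i)" using False i by simp
    ultimately obtain j where j: "j \<in> cands (rev P) z x" "split_at (rev P) z x j"
      using split_at_upper_half by blast
    then have "split_at P x z (length P - j)"
      using cands_le[OF j(1)] split_at_swap[of "length P - j" P x z] by simp
    then show ?thesis using j by blast
  qed
next
  assume "(\<exists>i \<in> cands P x z. split_at P x z i) \<or>
    (\<exists>j \<in> cands (rev P) z x. split_at P x z (length P - j))"
  then show "\<exists>i \<le> length P. split_at P x z i" using cands_le by fastforce
qed

lemma split_at_iff_append:
  "(\<exists>s p. suffix s x \<and> prefix p y \<and> P = s @ p) \<longleftrightarrow> (\<exists>i \<le> length P. split_at P x (rev y) i)"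
proof -
  have "(\<exists>s p. suffix s x \<and> prefix p y \<and> P = s @ p) \<longleftrightarrow>
      (\<exists>i \<le> length P. suffix (take i P) x \<and> prefix (drop i P) y)"
    by (metis append_eq_conv_conj append_take_drop_id le_add1 length_append)
  also have "\<dots> \<longleftrightarrow> (\<exists>i \<le> length P. split_at P x (rev y) i)"
    by (intro ex_cong1 conj_cong refl) (simp add: split_at_def overlap_rev_iff, simp add: overlap_def)
  finally show ?thesis .
qed

section \<open>Timed weakest preconditions\<close>

text \<open>Execution is deterministic, so the existential form also covers every run. The rules for
  basic commands are therefore equivalences, fit for the simplifier.\<close>

definition wpt :: "nat \<Rightarrow> com \<Rightarrow> (nat \<Rightarrow> state \<Rightarrow> bool) \<Rightarrow> state \<Rightarrow> bool" where
  "wpt w c Q s \<longleftrightarrow> (\<exists>t s'. exec w c s t s' \<and> Q t s')"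

lemma wptI: "exec w c s t s' \<Longrightarrow> Q t s' \<Longrightarrow> wpt w c Q s"
  by (auto simp: wpt_def)

lemma wpt_exec: "exec w c s t s' \<Longrightarrow> wpt w c Q s \<longleftrightarrow> Q t s'"
  unfolding wpt_def by (blast dest: exec_deterministic)

lemma wpt_Skip [simp]: "wpt w Skip Q s \<longleftrightarrow> Q 1 s"
  by (rule wpt_exec) (rule exec.Skip)

lemma wpt_Assign [simp]:
  "wpt w (Assign x e) Q s \<longleftrightarrow> Q (1 + cost e) (s\<lparr>reg := (reg s)(x := eval_expr w s e)\<rparr>)"
  by (rule wpt_exec) (rule exec.Assign)

lemma wpt_Store [simp]:
  "wpt w (Store a e1 e2) Q s \<longleftrightarrow> Q (1 + cost e1 + cost e2)
    (s\<lparr>mem := (mem s)(a := (mem s a)(eval_expr w s e1 := eval_expr w s e2))\<rparr>)"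
  by (rule wpt_exec) (rule exec.Store)

lemma wpt_Seq [simp]:
  "wpt w (Seq c1 c2) Q s \<longleftrightarrow> wpt w c1 (\<lambda>t1. wpt w c2 (\<lambda>t2. Q (t1 + t2))) s"
  unfolding wpt_def by (blast intro: exec.Seq elim: exec_SeqE)

lemma wpt_Cond [simp]:
  "wpt w (Cond b c1 c2) Q s \<longleftrightarrow>
    (if eval_expr w s b \<noteq> 0 then wpt w c1 (\<lambda>t. Q (1 + cost b + t)) s
     else wpt w c2 (\<lambda>t. Q (1 + cost b + t)) s)"
proof (cases "eval_expr w s b = 0")
  case True
  have "exec w (Cond b c1 c2) s t s' \<longleftrightarrow> (\<exists>t2. exec w c2 s t2 s' \<and> t = 1 + cost b + t2)" for t s'
    using True by (auto elim!: exec_CondE intro: exec.CondFalse[of w s b c2 _ s' c1, simplified])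
  then show ?thesis using True by (simp add: wpt_def) blast
next
  case False
  have "exec w (Cond b c1 c2) s t s' \<longleftrightarrow> (\<exists>t1. exec w c1 s t1 s' \<and> t = 1 + cost b + t1)" for t s'
    using False by (auto elim!: exec_CondE intro: exec.CondTrue[of w s b c1 _ s' c2, simplified])
  then show ?thesis using False by (simp add: wpt_def) blast
qed

text \<open>The bound on the elapsed time in the invariant makes the loop terminate.\<close>

lemma wpt_While:
  assumes init: "I 0 s"
    and bound: "\<And>t s. I t s \<Longrightarrow> t \<le> B"
    and step: "\<And>t s. I t s \<Longrightarrow> eval_expr w s b \<noteq> 0 \<Longrightarrow>
      wpt w c (\<lambda>t' s'. I (t + (1 + cost b) + t') s') s"
    and final: "\<And>t s. I t s \<Longrightarrow> eval_expr w s b = 0 \<Longrightarrow> Q (t + (1 + cost b)) s"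
  shows "wpt w (While b c) Q s"
proof -
  have "\<exists>t' s'. exec w (While b c) s t' s' \<and> Q (t + t') s'" if "I t s" for t s
    using that
  proof (induction "B - t" arbitrary: t s rule: less_induct)
    case less
    show ?case
    proof (cases "eval_expr w s b = 0")
      case True
      then show ?thesis using final[OF less.prems] by (blast intro: exec.WhileFalse)
    next
      case False
      from step[OF less.prems False] obtain t1 s1
        where 1: "exec w c s t1 s1" "I (t + (1 + cost b) + t1) s1" by (auto simp: wpt_def)
      \<comment> \<open>Every iteration spends at least one unit, so the remaining budget
        shrinks.\<close>
      then have "B - (t + (1 + cost b) + t1) < B - t" using bound[OF 1(2)] by simp
      from less.hyps[OF this 1(2)] obtain t2 s2
        where "exec w (While b c) s1 t2 s2" "Q (t + (1 + cost b) + t1 + t2) s2" by blast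
      then show ?thesis using exec.WhileTrue[OF False 1(1)] by (metis add.assoc)
    qed
  qed
  from this[OF init] show ?thesis by (simp add: wpt_def)
qed

text \<open>A positive word length makes 1 and the truth values representable. \<open>Mul\<close> is
  described on truth values only, since the programs use it as conjunction; the other side
  conditions exclude overflow.\<close>

lemma eval_simps:
  assumes "0 < w"
  shows "eval_expr w s (Const 0) = 0" "eval_expr w s (Const (Suc 0)) = Suc 0"
    "eval_expr w s (Bin Less a b) = of_bool (eval_expr w s a < eval_expr w s b)"
    "eval_expr w s (Bin Equal a b) = of_bool (eval_expr w s a = eval_expr w s b)"
    "eval_expr w s a = of_bool p \<Longrightarrow> eval_expr w s b = of_bool q \<Longrightarrow>
      eval_expr w s (Bin Mul a b) = of_bool (p \<and> q)"
    "eval_expr w s a + eval_expr w s b < 2 ^ w \<Longrightarrow>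
      eval_expr w s (Bin Add a b) = eval_expr w s a + eval_expr w s b"
    "eval_expr w s a < 2 ^ w \<Longrightarrow>
      eval_expr w s (Bin Sub a b) = eval_expr w s a - eval_expr w s b"
  using assms by (auto simp: less_imp_diff_less)

declare eval_expr.simps(4) [simp del]

section \<open>Matching one label\<close>

text \<open>
  Programs for one side take a character \<open>c\<close>, \<open>U\<close> or \<open>V\<close>, which is the first letter of the names
  private to that side. Array \<open>P\<close> is the pattern of the side, the reversed pattern for \<open>V\<close>, and
  \<open>F\<close> its failure table. Arrays \<open>A\<close>, \<open>D\<close> and \<open>B\<close> hold the results per node: the longest overlap,
  the end of the longest prefix of the label, read in the opposite direction, that has the period of
  the other side, and the stamps. Registers \<open>q\<close>, \<open>e\<close>,
  \<open>n\<close> and \<open>b\<close> hold the period of half the pattern, the end of its periodic prefix, the current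
  node and the start of its block in \<open>B\<close>.
\<close>

abbreviation test :: "char \<Rightarrow> expr \<Rightarrow> expr" where
  "test c e \<equiv> Bin Mul (Bin Less (Reg ''j'') (Reg ''m''))
    (Bin Equal (Load (c # ''P'') (Reg ''j'')) e)"

definition kmp_step :: "char \<Rightarrow> expr \<Rightarrow> com" where
  "kmp_step c e = Seq
    (While (Bin Mul (Bin Less (Const 0) (Reg ''j'')) (Bin Equal (test c e) (Const 0)))
      (Assign ''j'' (Load (c # ''F'') (Reg ''j''))))
    (Cond (test c e) (Assign ''j'' (Bin Add (Reg ''j'') (Const 1))) Skip)"

abbreviation set_j :: "nat \<Rightarrow> state \<Rightarrow> state" where
  "set_j v s \<equiv> s\<lparr>reg := (reg s)(''j'' := v)\<rparr>"

text \<open>A failure link costs less than 40 and lowers \<open>j\<close>, so \<open>40 * j\<close>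
  serves as potential; the 100 covers the last tests and the gain of 40 on a hit. \<open>F\<close>
  is required only up to the current \<open>j\<close>, so the step also runs while the table is
  being built.\<close>

lemma wpt_kmp_step:
  assumes w: "0 < w" and m: "reg s ''m'' = length P" and len: "length P < 2 ^ w"
    and P: "\<And>i. i < length P \<Longrightarrow> mem s (c # ''P'') i = P ! i"
    and F: "\<And>i. i \<le> reg s ''j'' \<Longrightarrow> mem s (c # ''F'') i = fail P i"
    and j: "reg s ''j'' = max_overlap P x"
    and e: "\<And>v. eval_expr w (set_j v s) e = a" and ce: "cost e \<le> 12"
    and Q: "\<And>t. t + 40 * max_overlap P (x @ [a]) \<le> 40 * max_overlap P x + 100 \<Longrightarrow>
      Q t (set_j (max_overlap P (x @ [a])) s)"
  shows "wpt w (kmp_step c e) Q s"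
proof -
  let ?ok = "\<lambda>j. j < length P \<and> P ! j = a"
  have test: "eval_expr w (set_j v s) (test c e) = of_bool (?ok v)" for v
    using P[of v] by (auto simp: eval_simps w m e)
  \<comment> \<open>Invariant: every overlap longer than the current \<open>j\<close> is known not
    to extend by \<open>a\<close>.\<close>
  let ?I = "\<lambda>t s'. \<exists>j. s' = set_j j s \<and> overlap P x j \<and> t + 40 * j \<le> 40 * max_overlap P x \<and>
    (\<forall>i. overlap P x i \<longrightarrow> j < i \<longrightarrow> \<not> ?ok i)"
  show ?thesis
    unfolding kmp_step_def wpt_Seq
  proof (rule wpt_While[where I = ?I and B = "40 * max_overlap P x"])
    have "set_j (max_overlap P x) s = s" by (simp add: j[symmetric])
    moreover have "\<not> ?ok i" if "overlap P x i" "max_overlap P x < i" for i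
      using max_overlap_ge[OF that(1)] that(2) by simp
    ultimately show "?I 0 s" using overlap_max_overlap[of P x] by (intro exI[of _ "max_overlap P x"] conjI) simp_all
  next
    fix t s' assume "?I t s'"
    then show "t \<le> 40 * max_overlap P x" by auto
  next
    fix t s'
    assume "?I t s'" and b: "eval_expr w s' (Bin Mul (Bin Less (Const 0) (Reg ''j''))
      (Bin Equal (test c e) (Const 0))) \<noteq> 0"
    then obtain j where j': "s' = set_j j s" "overlap P x j" "t + 40 * j \<le> 40 * max_overlap P x"
      "\<And>i. overlap P x i \<Longrightarrow> j < i \<Longrightarrow> \<not> ?ok i" by auto
    have "0 < j" "\<not> ?ok j" using b by (auto simp: j'(1) eval_simps w test split: if_splits)
    moreover have "j \<le> reg s ''j''" using j'(2) j max_overlap_ge by metis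
    moreover have "fail P j < j" using fail_less overlap_le \<open>0 < j\<close> j'(2) by blast
    ultimately
    show "wpt w (Assign ''j'' (Load (c # ''F'') (Reg ''j'')))
      (\<lambda>t' s'. ?I (t + (1 + cost (Bin Mul (Bin Less (Const 0) (Reg ''j''))
        (Bin Equal (test c e) (Const 0)))) + t') s') s'"
    proof -
      have "\<not> ?ok i" if "overlap P x i" "fail P j < i" for i
        using that j'(4) overlap_less_fail[OF j'(2), of i] \<open>\<not> ?ok j\<close> by (metis linorder_neqE_nat not_less)
      then show ?thesis
        using j'(1,3) ce overlap_fail_trans[OF j'(2)] \<open>fail P j < j\<close> F[OF \<open>j \<le> reg s ''j''\<close>]
        by (intro wpt_Assign[THEN iffD2] exI[of _ "fail P j"] conjI) auto
    qed
  next
    fix t s'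
    assume "?I t s'" and b: "eval_expr w s' (Bin Mul (Bin Less (Const 0) (Reg ''j''))
      (Bin Equal (test c e) (Const 0))) = 0"
    then obtain j where j': "s' = set_j j s" "overlap P x j" "t + 40 * j \<le> 40 * max_overlap P x"
      "\<And>i. overlap P x i \<Longrightarrow> j < i \<Longrightarrow> \<not> ?ok i" by auto
    have jj: "j = 0 \<or> ?ok j" using b by (auto simp: j'(1) eval_simps w test split: if_splits)
    show "wpt w (Cond (test c e) (Assign ''j'' (Bin Add (Reg ''j'') (Const 1))) Skip)
      (\<lambda>t2. Q (t + (1 + cost (Bin Mul (Bin Less (Const 0) (Reg ''j''))
        (Bin Equal (test c e) (Const 0)))) + t2)) s'"
    proof (cases "?ok j")
      case True
      then have "max_overlap P (x @ [a]) = Suc j" using max_overlap_snoc_hit[OF j'(2)] j'(4) by blast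
      then show ?thesis using Q True j' ce len
        by (simp add: test eval_simps w)
    next
      case False
      have "max_overlap P (x @ [a]) = 0" using max_overlap_snoc_miss[of P x a] j'(4) jj False by blast
      then have Q0: "Q t (set_j 0 s)" if "t \<le> 40 * max_overlap P x + 100" for t
        using Q[of t] that by simp
      have "eval_expr w s' (test c e) = 0" using False unfolding j'(1) test by simp
      moreover have "s' = set_j 0 s" using jj False j'(1) by blast
      ultimately show ?thesis
        using j'(3) ce by (auto simp only: wpt_Cond wpt_Skip cost.simps if_False simp_thms intro!: Q0)
    qed
  qed
qed

section \<open>Counting loops and the scan of a label\<close>

definition for_k :: "nat \<Rightarrow> name \<Rightarrow> com \<Rightarrow> com" where
  "for_k a n c = Seq (Assign ''k'' (Const a))
    (While (Bin Less (Reg ''k'') (Reg n)) (Seq c (Assign ''k'' (Bin Add (Reg ''k'') (Const 1)))))"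

abbreviation set_k :: "nat \<Rightarrow> state \<Rightarrow> state" where
  "set_k v s \<equiv> s\<lparr>reg := (reg s)(''k'' := v)\<rparr>"

text \<open>\<open>g\<close> is a potential, \<open>C\<close> the amortised cost of the body, and
  \<open>S\<close> the exact state before each round. The final index is \<open>max a N\<close>
  because the loop may start above its bound.\<close>

lemma wpt_for_k:
  assumes w: "0 < w" and N: "N < 2 ^ w" and a: "a < 2 ^ w"
    and k: "\<And>i. reg (S i) ''k'' = i" and n: "\<And>i. reg (S i) n = N"
    and start: "set_k a s = S a"
    and body: "\<And>i. a \<le> i \<Longrightarrow> i < N \<Longrightarrow> wpt w c (\<lambda>t s'. t + g (Suc i) \<le> g i + C \<and>
      reg s' ''k'' = i \<and> set_k (Suc i) s' = S (Suc i)) (S i)"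
    and Q: "\<And>t. t \<le> g a + (C + 10) * (N - a) + 10 \<Longrightarrow> Q t (S (max a N))"
  shows "wpt w (for_k a n c) Q s"
proof -
  let ?I = "\<lambda>t s. \<exists>i. a \<le> i \<and> i \<le> max a N \<and> s = S i \<and> t + g i \<le> g a + (C + 10) * (i - a)"
  show ?thesis
    unfolding for_k_def wpt_Seq wpt_Assign
  proof (rule wpt_While[where I = ?I and B = "g a + (C + 10) * (N - a)"])
    show "?I 0 (set_k (eval_expr w s (Const a)) s)"
      using start a by (intro exI[of _ a]) simp
  next
    fix t s assume "?I t s"
    then obtain i where i: "a \<le> i" "i \<le> max a N" "t + g i \<le> g a + (C + 10) * (i - a)" by blast
    have "i - a \<le> N - a" using i(1,2) by (cases "a \<le> N") auto
    then have "(C + 10) * (i - a) \<le> (C + 10) * (N - a)" by (intro mult_le_mono2)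
    then show "t \<le> g a + (C + 10) * (N - a)" using i(3) by linarith
  next
    fix t s
    assume "?I t s" and b: "eval_expr w s (Bin Less (Reg ''k'') (Reg n)) \<noteq> 0"
    then obtain i where i: "a \<le> i" "s = S i" "t + g i \<le> g a + (C + 10) * (i - a)" by blast
    have "i < N" using b by (simp add: i(2) eval_simps w k n split: if_splits)
    from body[OF i(1) this] obtain t' s' where
      "exec w c (S i) t' s'" "t' + g (Suc i) \<le> g i + C" "reg s' ''k'' = i" "set_k (Suc i) s' = S (Suc i)"
      by (auto simp: wpt_def)
    note c = this
    have k': "eval_expr w s' (Bin Add (Reg ''k'') (Const 1)) = Suc i"
      using c(3) \<open>i < N\<close> N w by (simp add: eval_simps)
    have "(C + 10) * (Suc i - a) = (C + 10) * (i - a) + C + 10"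
      using i by (simp add: Suc_diff_le)
    then have t: "t + (1 + cost (Bin Less (Reg ''k'') (Reg n))) +
        (t' + (1 + cost (Bin Add (Reg ''k'') (Const 1)))) + g (Suc i) \<le> g a + (C + 10) * (Suc i - a)"
      using i(3) c(2) by simp
    show "wpt w (Seq c (Assign ''k'' (Bin Add (Reg ''k'') (Const 1))))
      (\<lambda>t' s'. ?I (t + (1 + cost (Bin Less (Reg ''k'') (Reg n))) + t') s') s"
      unfolding wpt_Seq wpt_Assign i(2)
    proof (rule wptI[OF c(1)], intro exI conjI)
      show "a \<le> Suc i" "Suc i \<le> max a N" using i(1) \<open>i < N\<close> by auto
    qed (use c(4) k' t in simp_all)
  next
    fix t s
    assume "?I t s" and b: "eval_expr w s (Bin Less (Reg ''k'') (Reg n)) = 0"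
    then obtain i where i: "a \<le> i" "i \<le> max a N" "s = S i" "t + g i \<le> g a + (C + 10) * (i - a)"
      by blast
    have "N \<le> i" using b by (simp add: i(3) eval_simps w k n split: if_splits)
    then have "i = max a N" "i - a = N - a" using i by auto
    then show "Q (1 + cost (Const a) + (t + (1 + cost (Bin Less (Reg ''k'') (Reg n))))) s"
      using i Q by auto
  qed
qed

definition kmp_scan :: "char \<Rightarrow> expr \<Rightarrow> com" where
  "kmp_scan c e = Seq (Assign ''j'' (Const 0)) (for_k 0 ''n'' (kmp_step c e))"

text \<open>The potentials of the single steps telescope from 0, which leaves 100 per letter plus 10
  for the loop.\<close>

lemma wpt_kmp_scan:
  assumes w: "0 < w" and m: "reg s ''m'' = length P" and n: "reg s ''n'' = length x"
    and len: "length P < 2 ^ w" "length x < 2 ^ w"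
    and P: "\<And>i. i < length P \<Longrightarrow> mem s (c # ''P'') i = P ! i"
    and F: "\<And>i. i \<le> length P \<Longrightarrow> mem s (c # ''F'') i = fail P i"
    and e: "\<And>i v. i < length x \<Longrightarrow>
      eval_expr w (s\<lparr>reg := (reg s)(''k'' := i, ''j'' := v)\<rparr>) e = x ! i"
    and ce: "cost e \<le> 12"
    and Q: "\<And>t. t \<le> 110 * length x + 12 \<Longrightarrow>
      Q t (s\<lparr>reg := (reg s)(''j'' := max_overlap P x, ''k'' := length x)\<rparr>)"
  shows "wpt w (kmp_scan c e) Q s"
  unfolding kmp_scan_def wpt_Seq wpt_Assign
proof (rule wpt_for_k[where S = "\<lambda>i. s\<lparr>reg := (reg s)(''j'' := max_overlap P (take i x), ''k'' := i)\<rparr>"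
      and N = "length x" and g = "\<lambda>i. 40 * max_overlap P (take i x)" and C = 100])
  fix i assume i: "i < length x"
  show "wpt w (kmp_step c e) (\<lambda>t s'. t + 40 * max_overlap P (take (Suc i) x) \<le> 40 * max_overlap P (take i x) + 100 \<and>
      reg s' ''k'' = i \<and> set_k (Suc i) s' =
        s\<lparr>reg := (reg s)(''j'' := max_overlap P (take (Suc i) x), ''k'' := Suc i)\<rparr>)
      (s\<lparr>reg := (reg s)(''j'' := max_overlap P (take i x), ''k'' := i)\<rparr>)"
    by (rule wpt_kmp_step[where P = P and x = "take i x" and a = "x ! i"])
      (use w m len P F e i ce max_overlap_le(1)[of P "take i x"] in
        \<open>auto simp: take_Suc_conv_app_nth le_trans\<close>)
qed (use assms in \<open>auto\<close>)

text \<open>The chain of links ends at 0, whose cell is written separately. Since 0 is an overlap of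
  every label, this cell doubles as the mark of a visited node.\<close>

definition stamp :: "char \<Rightarrow> com" where
  "stamp c = Seq
    (While (Bin Less (Const 0) (Reg ''j''))
      (Seq (Store (c # ''B'') (Bin Add (Reg (c # ''b'')) (Reg ''j'')) (Bin Add (Reg (c # ''n'')) (Const 1)))
        (Assign ''j'' (Load (c # ''F'') (Reg ''j'')))))
    (Store (c # ''B'') (Reg (c # ''b'')) (Bin Add (Reg (c # ''n'')) (Const 1)))"

lemma wpt_stamp:
  assumes w: "0 < w" and j: "reg s ''j'' = max_overlap P x" and u: "reg s (c # ''n'') = u"
    and b: "reg s (c # ''b'') = b" and len: "b + length P < 2 ^ w" "Suc u < 2 ^ w"
    and F: "\<And>i. i \<le> length P \<Longrightarrow> mem s (c # ''F'') i = fail P i"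
    and Q: "\<And>t. t \<le> 40 * length x + 20 \<Longrightarrow>
      Q t (s\<lparr>reg := (reg s)(''j'' := 0), mem := (mem s)(c # ''B'' :=
        (\<lambda>i. if \<exists>k. i = b + k \<and> overlap P x k then Suc u else mem s (c # ''B'') i))\<rparr>)"
  shows "wpt w (stamp c) Q s"
proof -
  let ?S = "\<lambda>j. s\<lparr>reg := (reg s)(''j'' := j), mem := (mem s)(c # ''B'' :=
    (\<lambda>i. if \<exists>k. i = b + k \<and> overlap P x k \<and> j < k then Suc u else mem s (c # ''B'') i))\<rparr>"
  let ?I = "\<lambda>t s'. \<exists>j. s' = ?S j \<and> overlap P x j \<and> t + 40 * j \<le> 40 * max_overlap P x"
  show ?thesis
    unfolding stamp_def wpt_Seq
  proof (rule wpt_While[where I = ?I and B = "40 * max_overlap P x"])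
    have "(\<exists>k. i = b + k \<and> overlap P x k \<and> max_overlap P x < k) = False" for i
      using max_overlap_ge[of P x] by (auto simp: not_less[symmetric])
    then have "?S (max_overlap P x) = s" by (simp only: if_False) (simp add: j[symmetric])
    then show "?I 0 s" using overlap_max_overlap by (intro exI[of _ "max_overlap P x"]) auto
  next
    fix t s'
    assume "?I t s'" "eval_expr w s' (Bin Less (Const 0) (Reg ''j'')) \<noteq> 0"
    then obtain j where j': "s' = ?S j" "overlap P x j" "t + 40 * j \<le> 40 * max_overlap P x" "0 < j"
      by (auto simp: eval_simps w split: if_splits)
    have fj: "fail P j < j" "j \<le> length P" using fail_less overlap_le j' by blast+
    \<comment> \<open>Following one link adds exactly the cell of \<open>j\<close>, since no overlap
      lies strictly between \<open>fail P j\<close> and \<open>j\<close>.\<close>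
    have eq: "(\<exists>k. i = b + k \<and> overlap P x k \<and> fail P j < k) \<longleftrightarrow>
        i = b + j \<or> (\<exists>k. i = b + k \<and> overlap P x k \<and> j < k)" for i
      using j'(2) fj overlap_less_fail[OF j'(2)] by (metis less_trans linorder_neqE_nat not_less)
    show "wpt w (Seq (Store (c # ''B'') (Bin Add (Reg (c # ''b'')) (Reg ''j'')) (Bin Add (Reg (c # ''n'')) (Const 1)))
        (Assign ''j'' (Load (c # ''F'') (Reg ''j''))))
      (\<lambda>t' s'. ?I (t + (1 + cost (Bin Less (Const 0) (Reg ''j''))) + t') s') s'"
      unfolding wpt_Seq wpt_Store wpt_Assign
      by (rule exI[of _ "fail P j"])
        (use j' fj len u b w F overlap_fail_trans in \<open>auto simp: eval_simps eq fun_eq_iff intro!: state.equality\<close>)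
  next
    fix t s'
    assume "?I t s'" "eval_expr w s' (Bin Less (Const 0) (Reg ''j'')) = 0"
    then obtain j where j': "s' = ?S 0" "t \<le> 40 * max_overlap P x"
      by (auto simp: eval_simps w split: if_splits)
    have eq: "(\<exists>k. i = b + k \<and> overlap P x k) \<longleftrightarrow> i = b \<or> (\<exists>k. i = b + k \<and> overlap P x k \<and> 0 < k)" for i
      by (metis add_0_right neq0_conv overlap_0)
    have "s\<lparr>reg := (reg s)(''j'' := 0), mem := (mem s)(c # ''B'' :=
        (\<lambda>i. if \<exists>k. i = b + k \<and> overlap P x k then Suc u else mem s (c # ''B'') i))\<rparr> =
      s'\<lparr>mem := (mem s')(c # ''B'' := (mem s' (c # ''B''))(b := Suc u))\<rparr>"
      unfolding eq j' by (auto simp: fun_eq_iff intro!: state.equality)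
    then show "wpt w (Store (c # ''B'') (Reg (c # ''b'')) (Bin Add (Reg (c # ''n'')) (Const 1)))
      (\<lambda>t2. Q (t + (1 + cost (Bin Less (Const 0) (Reg ''j''))) + t2)) s'"
      using Q j'(2) u b w len max_overlap_le(2)[of P x] by (simp add: j'(1) eval_simps)
  qed auto
qed

definition extend :: "name \<Rightarrow> name \<Rightarrow> expr \<Rightarrow> expr \<Rightarrow> com" where
  "extend q n e1 e2 = Seq (Assign ''r'' (Reg q))
    (While (Bin Mul (Bin Less (Reg ''r'') (Reg n)) (Bin Equal e1 e2))
      (Assign ''r'' (Bin Add (Reg ''r'') (Const 1))))"

abbreviation set_r :: "nat \<Rightarrow> state \<Rightarrow> state" where
  "set_r v s \<equiv> s\<lparr>reg := (reg s)(''r'' := v)\<rparr>"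

text \<open>Time is charged to the growth of \<open>r\<close> above \<open>p\<close>. If
  \<open>p\<close> exceeds the length, the loop stops at once, so the cost stays linear in
  \<open>x\<close> whatever the period is.\<close>

lemma wpt_extend:
  assumes w: "0 < w" and q: "reg s q = p" and n: "reg s n = length x" "n \<noteq> ''r''"
    and len: "length x < 2 ^ w"
    and e1: "\<And>v. v < length x \<Longrightarrow> eval_expr w (set_r v s) e1 = x ! v"
    and e2: "\<And>v. p \<le> v \<Longrightarrow> v < length x \<Longrightarrow> eval_expr w (set_r v s) e2 = x ! (v - p)"
    and ce: "cost e1 \<le> 12" "cost e2 \<le> 12"
    and Q: "\<And>t. t \<le> 40 * length x + 40 \<Longrightarrow> Q t (set_r (period_end p x) s)"
  shows "wpt w (extend q n e1 e2) Q s"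
proof -
  let ?b = "Bin Mul (Bin Less (Reg ''r'') (Reg n)) (Bin Equal e1 e2)"
  let ?I = "\<lambda>t s'. \<exists>r. s' = set_r r s \<and> p \<le> r \<and> r \<le> max p (length x) \<and> t + 40 * p \<le> 40 * r \<and>
    (\<forall>k. p \<le> k \<longrightarrow> k < r \<longrightarrow> k < length x \<and> x ! k = x ! (k - p))"
  \<comment> \<open>Past the end the compared values are arbitrary, but the left factor is
    0.\<close>
  have b: "eval_expr w (set_r r s) ?b = of_bool (r < length x \<and> x ! r = x ! (r - p))" if "p \<le> r" for r
    using that n e1 e2 by (cases "r < length x") (auto simp: eval_simps w eval_simps(5)[OF w, where p = False])
  show ?thesis
    unfolding extend_def wpt_Seq wpt_Assign
  proof (rule wpt_While[where I = ?I and B = "40 * length x"])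
    show "?I 0 (set_r (eval_expr w s (Reg q)) s)" using q by auto
  next
    fix t s' assume "?I t s'"
    then show "t \<le> 40 * length x" by auto
  next
    fix t s'
    assume "?I t s'" "eval_expr w s' ?b \<noteq> 0"
    then obtain r where r: "s' = set_r r s" "p \<le> r" "t + 40 * p \<le> 40 * r"
      "\<forall>k. p \<le> k \<longrightarrow> k < r \<longrightarrow> k < length x \<and> x ! k = x ! (k - p)" "r < length x" "x ! r = x ! (r - p)"
      by (auto simp: b split: if_splits)
    show "wpt w (Assign ''r'' (Bin Add (Reg ''r'') (Const 1)))
        (\<lambda>t' s'. ?I (t + (1 + cost ?b) + t') s') s'"
      unfolding wpt_Assign
      by (rule exI[of _ "Suc r"])
        (use r len ce w in \<open>auto simp: eval_simps less_Suc_eq\<close>)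
  next
    fix t s'
    assume "?I t s'" "eval_expr w s' ?b = 0"
    then obtain r where r: "s' = set_r r s" "p \<le> r" "r \<le> max p (length x)" "t + 40 * p \<le> 40 * r"
      "\<And>k. p \<le> k \<Longrightarrow> k < r \<Longrightarrow> k < length x \<and> x ! k = x ! (k - p)"
      "r < length x \<Longrightarrow> x ! r \<noteq> x ! (r - p)"
      by (auto simp: b split: if_splits)
    have "period_end p x = r" by (rule period_end_eqI) (use r in auto)
    then show "Q (1 + cost (Reg q) + (t + (1 + cost ?b))) s'"
      using Q r(1-4) ce by auto
  qed
qed

section \<open>Preprocessing one orientation of the pattern\<close>

definition failure_table :: "char \<Rightarrow> com" where
  "failure_table c = Seq (Assign ''j'' (Const 0))
    (for_k 1 ''m'' (Seq (kmp_step c (Load (c # ''P'') (Reg ''k'')))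
      (Store (c # ''F'') (Bin Add (Reg ''k'') (Const 1)) (Reg ''j''))))"

definition set_period :: "char \<Rightarrow> com" where
  "set_period c =
    Seq (Assign ''h'' (Bin Div (Bin Add (Reg ''m'') (Const 1)) (Const 2)))
    (Seq (Assign (c # ''q'') (Bin Sub (Reg ''h'') (Load (c # ''F'') (Reg ''h''))))
    (Seq (extend (c # ''q'') ''m'' (Load (c # ''P'') (Reg ''r''))
      (Load (c # ''P'') (Bin Sub (Reg ''r'') (Reg (c # ''q'')))))
    (Assign (c # ''e'') (Reg ''r''))))"

definition prepare :: "char \<Rightarrow> expr \<Rightarrow> com" where
  "prepare c e =
    Seq (for_k 0 ''m'' (Store (c # ''P'') (Reg ''k'') e)) (Seq (failure_table c) (set_period c))"

text \<open>The reason why a scan of \<open>tl P\<close> computes the failure table.\<close>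

lemma max_overlap_take_tl_Suc: "max_overlap P (take i (tl P)) = fail P (Suc i)"
  by (simp add: fail_def take_tl)

lemma wpt_copy:
  assumes w: "0 < w" and m: "reg s ''m'' = length x" and len: "length x < 2 ^ w"
    and zero: "mem s (c # ''P'') = (\<lambda>_. 0)"
    and e: "\<And>i M. i < length x \<Longrightarrow>
      eval_expr w (s\<lparr>reg := (reg s)(''k'' := i), mem := (mem s)(c # ''P'' := M)\<rparr>) e = x ! i"
    and ce: "cost e \<le> 12"
    and Q: "\<And>t. t \<le> 30 * length x + 10 \<Longrightarrow>
      Q t (s\<lparr>reg := (reg s)(''k'' := length x),
        mem := (mem s)(c # ''P'' := (\<lambda>i. if i < length x then x ! i else 0))\<rparr>)"
  shows "wpt w (for_k 0 ''m'' (Store (c # ''P'') (Reg ''k'') e)) Q s"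
  by (rule wpt_for_k[where S = "\<lambda>k. s\<lparr>reg := (reg s)(''k'' := k),
        mem := (mem s)(c # ''P'' := (\<lambda>i. if i < k then x ! i else 0))\<rparr>"
      and N = "length x" and g = "\<lambda>_. 0" and C = 20])
    (use assms in \<open>auto simp: fun_eq_iff less_Suc_eq intro!: state.equality\<close>)

text \<open>Blank memory already provides entries 0 and 1, so the loop starts at 1.
  \<open>max 1 (length P)\<close> accounts for patterns with fewer than two letters, where it does
  not run.\<close>

lemma wpt_failure_table:
  assumes w: "0 < w" and m: "reg s ''m'' = length P" and len: "Suc (length P) < 2 ^ w"
    and P: "\<And>i. i < length P \<Longrightarrow> mem s (c # ''P'') i = P ! i"
    and zero: "mem s (c # ''F'') = (\<lambda>_. 0)"
    and Q: "\<And>t. t \<le> 140 * length P + 30 \<Longrightarrow>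
      Q t (s\<lparr>reg := (reg s)(''j'' := fail P (max 1 (length P)), ''k'' := max 1 (length P)),
        mem := (mem s)(c # ''F'' := (\<lambda>i. if i \<le> max 1 (length P) then fail P i else 0))\<rparr>)"
  shows "wpt w (failure_table c) Q s"
  unfolding failure_table_def wpt_Seq[of _ "Assign _ _"] wpt_Assign
proof (rule wpt_for_k[where S = "\<lambda>k. s\<lparr>reg := (reg s)(''j'' := fail P k, ''k'' := k),
        mem := (mem s)(c # ''F'' := (\<lambda>i. if i \<le> k then fail P i else 0))\<rparr>"
      and N = "length P" and g = "\<lambda>k. 40 * fail P k" and C = 120])
  fix k assume k: "1 \<le> k" "k < length P"
  then obtain i where i: "k = Suc i" by (cases k) auto
  \<comment> \<open>Round \<open>k\<close> reads \<open>P ! k\<close>, the letter of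
    \<open>tl P\<close> at position \<open>i\<close>, and advances from \<open>fail P k\<close> to
    \<open>fail P (Suc k)\<close>.\<close>
  have snoc: "take i (tl P) @ [P ! k] = take k (tl P)"
    using k by (simp add: i take_Suc_conv_app_nth nth_tl)
  have sn: "max_overlap P (take i (tl P) @ [P ! k]) = fail P (Suc k)" by (simp add: snoc max_overlap_take_tl_Suc)
  have st: "max_overlap P (take i (tl P)) = fail P k" by (simp add: i max_overlap_take_tl_Suc)
  let ?s = "s\<lparr>reg := (reg s)(''j'' := fail P k, ''k'' := k),
        mem := (mem s)(c # ''F'' := (\<lambda>i. if i \<le> k then fail P i else 0))\<rparr>"
  have le: "fail P k \<le> k" using fail_le[of k P] k by simp
  show "wpt w (Seq (kmp_step c (Load (c # ''P'') (Reg ''k'')))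
      (Store (c # ''F'') (Bin Add (Reg ''k'') (Const 1)) (Reg ''j'')))
      (\<lambda>t s'. t + 40 * fail P (Suc k) \<le> 40 * fail P k + 120 \<and> reg s' ''k'' = k \<and>
        set_k (Suc k) s' = s\<lparr>reg := (reg s)(''j'' := fail P (Suc k), ''k'' := Suc k),
        mem := (mem s)(c # ''F'' := (\<lambda>i. if i \<le> Suc k then fail P i else 0))\<rparr>) ?s"
    unfolding wpt_Seq
  proof (rule wpt_kmp_step[where P = P and x = "take i (tl P)" and a = "P ! k"])
    fix t assume "t + 40 * max_overlap P (take i (tl P) @ [P ! k]) \<le> 40 * max_overlap P (take i (tl P)) + 100"
    then have t: "t + 40 * fail P (Suc k) \<le> 40 * fail P k + 100"
unfolding sn st .
    show "wpt w (Store (c # ''F'') (Bin Add (Reg ''k'') (Const 1)) (Reg ''j''))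
      (\<lambda>t2 s'. t + t2 + 40 * fail P (Suc k) \<le> 40 * fail P k + 120 \<and> reg s' ''k'' = k \<and>
        set_k (Suc k) s' = s\<lparr>reg := (reg s)(''j'' := fail P (Suc k), ''k'' := Suc k),
        mem := (mem s)(c # ''F'' := (\<lambda>i. if i \<le> Suc k then fail P i else 0))\<rparr>)
      (set_j (max_overlap P (take i (tl P) @ [P ! k])) ?s)"
      unfolding sn
      using t k w len by (auto simp: eval_simps fun_eq_iff le_Suc_eq intro!: state.equality)
  qed (use w m len P k le in \<open>auto simp: st\<close>)
next
  fix t assume "t \<le> 40 * fail P 1 + (120 + 10) * (length P - 1) + 10"
  then show "Q (1 + cost (Const 0) + t) (s\<lparr>reg := (reg s)(''j'' := fail P (max 1 (length P)), ''k'' := max 1 (length P)),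
        mem := (mem s)(c # ''F'' := (\<lambda>i. if i \<le> max 1 (length P) then fail P i else 0))\<rparr>)"
    using Q by simp
qed (use assms in \<open>auto simp: fun_eq_iff le_Suc_eq intro!: state.equality\<close>)

lemma wpt_set_period:
  assumes w: "0 < w" and m: "reg s ''m'' = length P" and len: "4 * (length P + 1) \<le> 2 ^ w"
    and P: "\<And>i. i < length P \<Longrightarrow> mem s (c # ''P'') i = P ! i"
    and F: "\<And>i. i \<le> length P \<Longrightarrow> mem s (c # ''F'') i = fail P i"
    and Q: "\<And>t s'. t \<le> 40 * length P + 100 \<Longrightarrow>
      reg s' (c # ''q'') = half_period P \<Longrightarrow> reg s' (c # ''e'') = period_end (half_period P) P \<Longrightarrow> mem s' = mem s \<Longrightarrow>
      (\<And>x. x \<notin> {''h'', ''r'', c # ''q'', c # ''e''} \<Longrightarrow> reg s' x = reg s x) \<Longrightarrow> Q t s'"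
  shows "wpt w (set_period c) Q s"
proof -
  define h where "h = (length P + 1) div 2"
  have h: "h \<le> length P" by (cases P) (auto simp: h_def)
  have q: "half_period P = h - fail P h" by (simp add: half_period_def h_def)
  \<comment> \<open>The factor 4 makes the constant 2 of the halving representable even for an empty
    pattern.\<close>
  have len': "length P < 2 ^ w" "Suc (length P) < 2 ^ w" "Suc (Suc 0) < 2 ^ w" using len by auto
  have hv: "eval_expr w s (Bin Div (Bin Add (Reg ''m'') (Const 1)) (Const 2)) = h"
    using m len' w h by (simp add: h_def eval_simps eval_expr.simps(4))
  let ?s1 = "s\<lparr>reg := (reg s)(''h'' := h)\<rparr>"
  have qv: "eval_expr w ?s1 (Bin Sub (Reg ''h'') (Load (c # ''F'') (Reg ''h''))) = half_period P"
    using len' w h F by (simp add: q eval_simps)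
  let ?s2 = "s\<lparr>reg := (reg s)(''h'' := h, c # ''q'' := half_period P)\<rparr>"
  have "wpt w (extend (c # ''q'') ''m'' (Load (c # ''P'') (Reg ''r''))
      (Load (c # ''P'') (Bin Sub (Reg ''r'') (Reg (c # ''q'')))))
    (\<lambda>t s'. t \<le> 40 * length P + 40 \<and> s' = set_r (period_end (half_period P) P) ?s2) ?s2"
    by (rule wpt_extend[where x = P and p = "half_period P"])
      (use w m P len' in \<open>auto simp: eval_simps\<close>)
  then obtain t where t: "t \<le> 40 * length P + 40" "exec w (extend (c # ''q'') ''m'' (Load (c # ''P'') (Reg ''r''))
      (Load (c # ''P'') (Bin Sub (Reg ''r'') (Reg (c # ''q''))))) ?s2 t (set_r (period_end (half_period P) P) ?s2)"
    by (auto simp: wpt_def)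
  show ?thesis
    unfolding set_period_def wpt_Seq wpt_Assign hv qv
    by (simp add: qv wpt_exec[OF t(2)]) (rule Q, use t(1) in auto)
qed

lemma wpt_prepare:
  assumes w: "0 < w" and m: "reg s ''m'' = length P" and len: "4 * (length P + 1) \<le> 2 ^ w"
    and zero: "mem s (c # ''P'') = (\<lambda>_. 0)" "mem s (c # ''F'') = (\<lambda>_. 0)"
    and e: "\<And>i M. i < length P \<Longrightarrow>
      eval_expr w (s\<lparr>reg := (reg s)(''k'' := i), mem := (mem s)(c # ''P'' := M)\<rparr>) e = P ! i"
    and ce: "cost e \<le> 12"
    and Q: "\<And>t s'. t \<le> 300 * length P + 200 \<Longrightarrow>
      (\<And>i. i < length P \<Longrightarrow> mem s' (c # ''P'') i = P ! i) \<Longrightarrow>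
      (\<And>i. i \<le> length P \<Longrightarrow> mem s' (c # ''F'') i = fail P i) \<Longrightarrow>
      reg s' (c # ''q'') = half_period P \<Longrightarrow> reg s' (c # ''e'') = period_end (half_period P) P \<Longrightarrow>
      (\<And>a. a \<notin> {c # ''P'', c # ''F''} \<Longrightarrow> mem s' a = mem s a) \<Longrightarrow>
      (\<And>x. x \<notin> {''j'', ''k'', ''h'', ''r'', c # ''q'', c # ''e''} \<Longrightarrow> reg s' x = reg s x) \<Longrightarrow> Q t s'"
  shows "wpt w (prepare c e) Q s"
proof -
  have len': "length P < 2 ^ w" "Suc (length P) < 2 ^ w" using len by auto
  show ?thesis
    unfolding prepare_def wpt_Seq
    apply (rule wpt_copy[where x = P, OF w m len'(1) zero(1) e ce], assumption)
    apply (rule wpt_failure_table[where P = P, OF w _ len'(2)])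
       apply (simp add: m)
      apply simp
     apply (simp add: zero)
    apply (rule wpt_set_period[where P = P, OF w _ len])
       apply (simp add: m)
      apply simp
     apply simp
    apply (rule Q)
          apply simp
         apply simp
        apply simp
       apply simp
      apply simp
     apply simp
    apply simp
    done
qed

section \<open>Visiting one node\<close>

definition read_label :: "bool \<Rightarrow> char \<Rightarrow> expr \<Rightarrow> expr" where
  "read_label fwd c k = Load (c # ''_text'')
    (if fwd then Bin Add (Reg ''o'') k
     else Bin Sub (Bin Add (Reg ''o'') (Reg ''n'')) (Bin Add k (Const 1)))"

text \<open>The scan and the period search read the label in opposite directions; backward indexing
  avoids a copy. The period is that of side \<open>d\<close>, because \<open>D\<close> enters the
  candidates of that side.\<close>

definition process_node :: "char \<Rightarrow> char \<Rightarrow> bool \<Rightarrow> com" where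
  "process_node c d fwd =
    Seq (Assign ''o'' (Load (c # ''_offset'') (Reg (c # ''n''))))
    (Seq (Assign ''n'' (Bin Sub (Load (c # ''_offset'') (Bin Add (Reg (c # ''n'')) (Const 1))) (Reg ''o'')))
    (Seq (kmp_scan c (read_label fwd c (Reg ''k'')))
    (Seq (Store (c # ''A'') (Reg (c # ''n'')) (Reg ''j''))
    (Seq (stamp c)
    (Seq (extend (d # ''q'') ''n'' (read_label (\<not> fwd) c (Reg ''r''))
      (read_label (\<not> fwd) c (Bin Sub (Reg ''r'') (Reg (d # ''q'')))))
    (Store (c # ''D'') (Reg (c # ''n'')) (Reg ''r'')))))))"

lemma eval_read_label:
  assumes w: "0 < w" and t: "\<And>i. i < length l \<Longrightarrow> mem s (c # ''_text'') (b + i) = l ! i"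
    and r: "reg s ''o'' = b" "reg s ''n'' = length l" and len: "b + length l < 2 ^ w"
    and k: "eval_expr w s k = i" "i < length l"
  shows "eval_expr w s (read_label fwd c k) = (if fwd then l else rev l) ! i"
proof -
  have "b + i < 2 ^ w" "Suc i < 2 ^ w" using len k by auto
  moreover have "mem s (c # ''_text'') (b + length l - Suc i) = l ! (length l - Suc i)"
    using t[of "length l - Suc i"] k by simp
  ultimately show ?thesis
    using assms by (auto simp: read_label_def eval_simps rev_nth)
qed

lemma cost_read_label: "cost (read_label fwd c k) \<le> cost k + 8"
  by (simp add: read_label_def)

text \<open>The 190 per letter are 110 for the scan, 40 for stamping and 40 for the period
  search.\<close>

lemma wpt_process_node:
  assumes w: "0 < w" and m: "reg s ''m'' = length P" and len: "b + u + length l + length P + 1 < 2 ^ w"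
    and P: "\<And>i. i < length P \<Longrightarrow> mem s (c # ''P'') i = P ! i"
    and F: "\<And>i. i \<le> length P \<Longrightarrow> mem s (c # ''F'') i = fail P i"
    and u: "reg s (c # ''n'') = u" "reg s (c # ''b'') = b + u" and q: "reg s (d # ''q'') = q"
    and o: "mem s (c # ''_offset'') u = b" "mem s (c # ''_offset'') (Suc u) = b + length l"
    and t: "\<And>i. i < length l \<Longrightarrow> mem s (c # ''_text'') (b + i) = l ! i"
    and x: "x = (if fwd then l else rev l)"
    and Q: "\<And>t s'. t \<le> 190 * length l + 200 \<Longrightarrow>
      mem s' (c # ''A'') = (mem s (c # ''A''))(u := max_overlap P x) \<Longrightarrow>
      mem s' (c # ''D'') = (mem s (c # ''D''))(u := period_end q (rev x)) \<Longrightarrow>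
      mem s' (c # ''B'') =
        (\<lambda>i. if \<exists>k. i = b + u + k \<and> overlap P x k then Suc u else mem s (c # ''B'') i) \<Longrightarrow>
      (\<And>a. a \<notin> {c # ''A'', c # ''B'', c # ''D''} \<Longrightarrow> mem s' a = mem s a) \<Longrightarrow>
      (\<And>y. y \<notin> {''j'', ''k'', ''o'', ''n'', ''r''} \<Longrightarrow> reg s' y = reg s y) \<Longrightarrow> Q t s'"
  shows "wpt w (process_node c d fwd) Q s"
proof -
  have len': "length P < 2 ^ w" "length x < 2 ^ w" "length (rev x) < 2 ^ w" "b + length l < 2 ^ w"
    "b + u + length P < 2 ^ w" "Suc u < 2 ^ w" using len x by auto
  have lx: "length x = length l" "rev x = (if \<not> fwd then l else rev l)" by (simp_all add: x)
  have o': "eval_expr w (s\<lparr>reg := (reg s)(''o'' := b)\<rparr>)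
      (Bin Sub (Load (c # ''_offset'') (Bin Add (Reg (c # ''n'')) (Const 1))) (Reg ''o'')) = length x"
    using w len' u o by (simp add: eval_simps lx(1))
  have c1: "cost (read_label fwd c (Reg ''k'')) \<le> 12" for fwd
    using cost_read_label[of fwd c "Reg ''k''"] by simp
  have c2: "cost (read_label fwd c (Reg ''r'')) \<le> 12"
    "cost (read_label fwd c (Bin Sub (Reg ''r'') (Reg (d # ''q'')))) \<le> 12" for fwd
    by (rule order.trans[OF cost_read_label], simp)+
  have "eval_expr w s (Load (c # ''_offset'') (Reg (c # ''n''))) = b" using u o by simp
  note ev = this o'
  show ?thesis
    unfolding process_node_def wpt_Seq wpt_Assign wpt_Store
    apply (simp only: ev)
    apply (rule wpt_kmp_scan[where P = P and x = x, OF w _ _ len'(1,2) _ _ _ c1])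
         apply (simp add: m)
        apply simp
       apply (simp add: P)
      apply (simp add: F)
     apply (subst x, rule eval_read_label[OF w, where b = b])
          apply (simp add: t)
         apply simp
        apply (simp add: lx)
       apply (rule len')
      apply simp
     apply (simp add: lx)
    apply (rule wpt_stamp[where P = P and x = x and u = u and b = "b + u", OF w])
          apply simp
         apply (simp add: u)
        apply (simp add: u)
       apply (rule len')
      apply (rule len')
     apply (simp add: F)
    apply (rule wpt_extend[where x = "rev x" and p = q, OF w])
            apply (simp add: q)
           apply simp
          apply simp
         apply (rule len')
        apply (subst lx(2), rule eval_read_label[OF w, where b = b])
             apply (simp add: t)
            apply simp
           apply (simp add: lx)
          apply (rule len')
         apply simp
        apply (simp add: lx(1))
       apply (subst lx(2), rule eval_read_label[OF w, where b = b])
            apply (simp add: t)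
           apply simp
          apply (simp add: lx)
         apply (rule len')
        apply (use len' q w in \<open>simp add: eval_simps lx\<close>)
       apply (simp add: lx(1) less_imp_diff_less)
      apply (rule c2)+
    apply (rule Q)
         apply (simp add: lx(1))
        apply (simp add: u)
       apply (simp add: u)
      apply (auto simp: fun_eq_iff)[1]
     apply simp
    apply simp
    done
qed

section \<open>Layout of the stamps\<close>

definition offset :: "'a list list \<Rightarrow> nat \<Rightarrow> nat" where
  "offset xss u = length (concat (take u xss))"

lemma offset_Suc: "u < length xss \<Longrightarrow> offset xss (Suc u) = offset xss u + length (xss ! u)"
  by (simp add: offset_def take_Suc_conv_app_nth)

lemma offset_mono: "u \<le> v \<Longrightarrow> offset xss u \<le> offset xss v"
  using take_take[of u v xss] append_take_drop_id[of u "take v xss"]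
  by (metis concat_append le_add1 length_append min.absorb1 offset_def)

lemma offset_le: "offset xss u \<le> length (concat xss)"
  by (metis append_take_drop_id concat_append le_add1 length_append offset_def)

lemma nth_concat_offset:
  assumes "u < length xss" "i < length (xss ! u)"
  shows "concat xss ! (offset xss u + i) = xss ! u ! i" "offset xss u + i < length (concat xss)"
proof -
  have "concat xss = concat (take u xss) @ xss ! u @ concat (drop (Suc u) xss)"
    using assms(1) by (metis concat.simps(2) concat_append id_take_nth_drop)
  then show "concat xss ! (offset xss u + i) = xss ! u ! i"
    using assms(2) by (simp add: offset_def nth_append)
  show "offset xss u + i < length (concat xss)"
    using offset_Suc[OF assms(1)] offset_le[of xss "Suc u"] assms(2) by simp
qed

text \<open>The summand \<open>u\<close> widens every block by one cell, giving room for overlaps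
  from 0 up to the label length. Even an empty label owns a cell.\<close>

lemma nodes_disjoint:
  assumes "u < length xss" "v < length xss" "i \<le> length (xss ! u)" "j \<le> length (xss ! v)"
    and "offset xss u + u + i = offset xss v + v + j"
  shows "u = v"
proof -
  have "\<not> u < v" if "u < length xss" "i \<le> length (xss ! u)" "offset xss u + u + i = offset xss v + v + j" for u v i j
    using that offset_Suc[of u xss] offset_mono[of "Suc u" v xss] by auto
  from this[of u i v j] this[of v j u i] show ?thesis using assms by auto
qed

definition orient :: "bool \<Rightarrow> 'a list \<Rightarrow> 'a list" where
  "orient fwd l = (if fwd then l else rev l)"

lemma length_orient [simp]: "length (orient fwd l) = length l"
  by (simp add: orient_def)

definition loaded :: "char \<Rightarrow> nat list list \<Rightarrow> nat list \<Rightarrow> state \<Rightarrow> bool" where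
  "loaded c Ls P s \<longleftrightarrow>
    reg s ''m'' = length P \<and> reg s (c # ''q'') = half_period P \<and> reg s (c # ''e'') = period_end (half_period P) P \<and>
    (\<forall>i < length P. mem s (c # ''P'') i = P ! i) \<and> (\<forall>i \<le> length P. mem s (c # ''F'') i = fail P i) \<and>
    (\<forall>u \<le> length Ls. mem s (c # ''_offset'') u = offset Ls u) \<and>
    (\<forall>i < length (concat Ls). mem s (c # ''_text'') i = concat Ls ! i)"

definition visited :: "char \<Rightarrow> nat list list \<Rightarrow> state \<Rightarrow> nat set" where
  "visited c Ls s = {u. u < length Ls \<and> mem s (c # ''B'') (offset Ls u + u) = Suc u}"

definition visited_size :: "char \<Rightarrow> nat list list \<Rightarrow> state \<Rightarrow> nat" where
  "visited_size c Ls s = (\<Sum>u \<in> visited c Ls s. length (Ls ! u))"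

text \<open>
  Cell \<open>offset Ls u + u + i\<close> of the array \<open>B\<close> holds \<open>Suc u\<close> if and only if node \<open>u\<close> has been visited
  and its label matches at \<open>i\<close>. An index outside the block of \<open>u\<close> never carries the stamp \<open>Suc u\<close>,
  so no bounds check is needed when a candidate is looked up.
\<close>

definition stamps_ok :: "char \<Rightarrow> bool \<Rightarrow> nat list list \<Rightarrow> nat list \<Rightarrow> state \<Rightarrow> bool" where
  "stamps_ok c fwd Ls P s \<longleftrightarrow>
    (\<forall>u < length Ls. \<forall>i. mem s (c # ''B'') (offset Ls u + u + i) = Suc u \<longrightarrow> overlap P (orient fwd (Ls ! u)) i) \<and>
    (\<forall>u \<in> visited c Ls s.
      (\<forall>i. overlap P (orient fwd (Ls ! u)) i \<longrightarrow> mem s (c # ''B'') (offset Ls u + u + i) = Suc u) \<and>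
      mem s (c # ''A'') u = max_overlap P (orient fwd (Ls ! u)) \<and>
      mem s (c # ''D'') u = period_end (half_period (rev P)) (rev (orient fwd (Ls ! u))))"

definition visit :: "char \<Rightarrow> char \<Rightarrow> bool \<Rightarrow> com" where
  "visit c d fwd =
    Seq (Assign (c # ''b'') (Bin Add (Load (c # ''_offset'') (Reg (c # ''n''))) (Reg (c # ''n''))))
    (Cond (Bin Equal (Load (c # ''B'') (Reg (c # ''b''))) (Bin Add (Reg (c # ''n'')) (Const 1)))
      Skip (process_node c d fwd))"

lemma stamps_ok_update:
  assumes s: "stamps_ok c fwd Ls P s" and u: "u < length Ls" and x: "x = orient fwd (Ls ! u)"
    and A: "mem s' (c # ''A'') = (mem s (c # ''A''))(u := max_overlap P x)"
    and D: "mem s' (c # ''D'') = (mem s (c # ''D''))(u := period_end (half_period (rev P)) (rev x))"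
    and B: "mem s' (c # ''B'') =
      (\<lambda>i. if \<exists>k. i = offset Ls u + u + k \<and> overlap P x k then Suc u else mem s (c # ''B'') i)"
  shows "stamps_ok c fwd Ls P s'" "visited c Ls s' = insert u (visited c Ls s)"
proof -
  have le: "k \<le> length (Ls ! v)" if "overlap P (orient fwd (Ls ! v)) k" for v k
    using overlap_le[OF that] by simp
  \<comment> \<open>Stamps already present in the block are justified by the invariant, so after the
    update exactly the overlaps are stamped.\<close>
  have B_u: "mem s' (c # ''B'') (offset Ls u + u + i) = Suc u \<longleftrightarrow>
      overlap P x i" for i
    using s u x by (auto simp: B stamps_ok_def)
  \<comment> \<open>No stamp of another node \<open>v\<close> appears, as the written value is
    \<open>Suc u\<close>; none disappears, as valid stamps of \<open>v\<close> lie in its own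
    block.\<close>
  have B_v: "mem s' (c # ''B'') (offset Ls v + v + i) = Suc v \<longleftrightarrow>
      mem s (c # ''B'') (offset Ls v + v + i) = Suc v" if "v \<noteq> u" "v < length Ls" for v i
  proof (cases "\<exists>k. offset Ls v + v + i = offset Ls u + u + k \<and> overlap P x k")
    case True
    then obtain k where k: "offset Ls v + v + i = offset Ls u + u + k" "overlap P x k" by blast
    have "\<not> mem s (c # ''B'') (offset Ls v + v + i) = Suc v"
    proof
      assume "mem s (c # ''B'') (offset Ls v + v + i) = Suc v"
      then have "overlap P (orient fwd (Ls ! v)) i" using s that by (auto simp: stamps_ok_def)
      then show False using nodes_disjoint[OF that(2) u le le k(1)] k(2) x that(1) by blast
    qed
    moreover have "mem s' (c # ''B'') (offset Ls v + v + i) = Suc u" using True by (simp add: B)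
    ultimately show ?thesis using that by simp
  next
    case False
    then show ?thesis unfolding B by (simp only: if_False)
  qed
  show vis: "visited c Ls s' = insert u (visited c Ls s)"
  proof (rule set_eqI)
    fix v show "v \<in> visited c Ls s' \<longleftrightarrow> v \<in> insert u (visited c Ls s)"
      using B_u[of 0] B_v[of v 0] u by (cases "v = u"; cases "v < length Ls") (auto simp: visited_def)
  qed
  show "stamps_ok c fwd Ls P s'"
    unfolding stamps_ok_def vis
  proof (intro conjI ballI allI impI)
    fix v i assume "v < length Ls" "mem s' (c # ''B'') (offset Ls v + v + i) = Suc v"
    then show "overlap P (orient fwd (Ls ! v)) i"
      using B_u[of i] B_v[of v i] s x by (cases "v = u") (auto simp: stamps_ok_def)
  next
    fix v i assume "v \<in> insert u (visited c Ls s)" "overlap P (orient fwd (Ls ! v)) i"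
    then show "mem s' (c # ''B'') (offset Ls v + v + i) = Suc v"
      using B_u[of i] B_v[of v i] s x by (cases "v = u") (auto simp: stamps_ok_def visited_def)
  next
    fix v assume "v \<in> insert u (visited c Ls s)"
    then show "mem s' (c # ''A'') v = max_overlap P (orient fwd (Ls ! v))"
      "mem s' (c # ''D'') v = period_end (half_period (rev P)) (rev (orient fwd (Ls ! v)))"
      using s x by (auto simp: stamps_ok_def A D)
  qed
qed

lemma finite_visited: "finite (visited c Ls s)"
  by (simp add: visited_def)

text \<open>A node that becomes visited adds 200 per letter to the potential, which pays for
  processing it. On later visits only the constant-time stamp test remains.\<close>

lemma wpt_visit:
  assumes w: "0 < w" and len: "4 * (length P + length Ls + length (concat Ls) + 1) \<le> 2 ^ w"
    and l: "loaded c Ls P s" and q: "reg s (d # ''q'') = half_period (rev P)"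
    and s: "stamps_ok c fwd Ls P s" and u: "reg s (c # ''n'') = u" "u < length Ls"
    and Q: "\<And>t s'. t + 200 * visited_size c Ls s \<le> 220 + 200 * visited_size c Ls s' \<Longrightarrow>
      stamps_ok c fwd Ls P s' \<Longrightarrow> u \<in> visited c Ls s' \<Longrightarrow> reg s' (c # ''b'') = offset Ls u + u \<Longrightarrow>
      (\<And>a. a \<notin> {c # ''A'', c # ''B'', c # ''D''} \<Longrightarrow> mem s' a = mem s a) \<Longrightarrow>
      (\<And>y. y \<notin> {''j'', ''k'', ''o'', ''n'', ''r'', c # ''b''} \<Longrightarrow> reg s' y = reg s y) \<Longrightarrow> Q t s'"
  shows "wpt w (visit c d fwd) Q s"
proof -
  let ?l = "Ls ! u"
  let ?b = "offset Ls u + u"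
  let ?s = "s\<lparr>reg := (reg s)(c # ''b'' := ?b)\<rparr>"
  have "offset Ls u + length ?l \<le> length (concat Ls)"
    using offset_Suc[OF u(2)] offset_le[of Ls "Suc u"] by simp
  then have "offset Ls u + u + length ?l + length P + 1 < 4 * (length P + length Ls + length (concat Ls) + 1)"
    using u(2) by simp
  then have len3: "offset Ls u + u + length ?l + length P + 1 < 2 ^ w"
    using len by (rule less_le_trans)
  then have len': "offset Ls u + u < 2 ^ w" "Suc u < 2 ^ w" by simp_all
  have b: "eval_expr w s (Bin Add (Load (c # ''_offset'') (Reg (c # ''n''))) (Reg (c # ''n''))) = ?b"
    using l u w len' by (simp add: loaded_def eval_simps)
  have s': "stamps_ok c fwd Ls P ?s" using s by (simp add: stamps_ok_def visited_def)
  have vis: "visited c Ls ?s = visited c Ls s" by (simp add: visited_def)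
  have test: "eval_expr w ?s (Bin Equal (Load (c # ''B'') (Reg (c # ''b''))) (Bin Add (Reg (c # ''n'')) (Const 1)))
      = of_bool (u \<in> visited c Ls s)"
    using u w len' by (simp add: eval_simps visited_def)
  show ?thesis
  proof (cases "u \<in> visited c Ls s")
    case True
    then show ?thesis
      unfolding visit_def wpt_Seq wpt_Assign b wpt_Cond test using s' vis
      by (auto intro!: Q simp: visited_size_def split: if_splits)
  next
    case False
    have "wpt w (process_node c d fwd)
      (\<lambda>t. Q (1 + cost (Bin Add (Load (c # ''_offset'') (Reg (c # ''n''))) (Reg (c # ''n''))) +
        (1 + cost (Bin Equal (Load (c # ''B'') (Reg (c # ''b''))) (Bin Add (Reg (c # ''n'')) (Const 1))) + t))) ?s"
    proof (rule wpt_process_node[where P = P and l = ?l and x = "orient fwd ?l" and u = u and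
          b = "offset Ls u" and q = "half_period (rev P)"])
      fix t and s1 :: state
      assume t: "t \<le> 190 * length ?l + 200"
        and A: "mem s1 (c # ''A'') = (mem ?s (c # ''A''))(u := max_overlap P (orient fwd ?l))"
        and D: "mem s1 (c # ''D'') = (mem ?s (c # ''D''))(u := period_end (half_period (rev P)) (rev (orient fwd ?l)))"
        and B: "mem s1 (c # ''B'') = (\<lambda>i. if \<exists>k. i = offset Ls u + u + k \<and> overlap P (orient fwd ?l) k
          then Suc u else mem ?s (c # ''B'') i)"
        and mem: "\<And>a. a \<notin> {c # ''A'', c # ''B'', c # ''D''} \<Longrightarrow> mem s1 a = mem ?s a"
        and reg: "\<And>y. y \<notin> {''j'', ''k'', ''o'', ''n'', ''r''} \<Longrightarrow> reg s1 y = reg ?s y"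
      have up: "stamps_ok c fwd Ls P s1" "visited c Ls s1 = insert u (visited c Ls s)"
        using stamps_ok_update[OF s' u(2) refl, of s1] A D B vis by simp_all
      have "visited_size c Ls s1 = visited_size c Ls s + length ?l"
        unfolding visited_size_def up(2) using False by (simp add: finite_visited)
      then show "Q (1 + cost (Bin Add (Load (c # ''_offset'') (Reg (c # ''n''))) (Reg (c # ''n''))) +
        (1 + cost (Bin Equal (Load (c # ''B'') (Reg (c # ''b''))) (Bin Add (Reg (c # ''n'')) (Const 1))) + t)) s1"
        using up t mem reg by (intro Q) auto
    qed (use w l u q len3 offset_Suc[OF u(2)] nth_concat_offset[OF u(2)] in \<open>auto simp: loaded_def orient_def\<close>)
    then show ?thesis
      unfolding visit_def wpt_Seq wpt_Assign b wpt_Cond test using False by simp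
  qed
qed

section \<open>Processing all edges\<close>

lemma wptE:
  assumes "wpt w c Q s"
  obtains t s' where "exec w c s t s'" "Q t s'"
  using assms by (auto simp: wpt_def)

lemma loaded_cong:
  assumes "loaded c Ls P s" "\<forall>a \<in> {c # ''P'', c # ''F'', c # ''_offset'', c # ''_text''}. mem s' a = mem s a"
    "\<forall>y \<in> {''m'', c # ''q'', c # ''e''}. reg s' y = reg s y"
  shows "loaded c Ls P s'"
  using assms by (simp add: loaded_def)

lemma stamps_cong:
  assumes "\<forall>a \<in> {c # ''A'', c # ''B'', c # ''D''}. mem s' a = mem s a"
  shows "visited c Ls s' = visited c Ls s" "visited_size c Ls s' = visited_size c Ls s"
    "stamps_ok c fwd Ls P s' \<longleftrightarrow> stamps_ok c fwd Ls P s"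
  using assms by (simp_all add: visited_size_def visited_def stamps_ok_def)

lemma visited_size_le: "visited_size c Ls s \<le> length (concat Ls)"
proof -
  have "visited_size c Ls s \<le> (\<Sum>u<length Ls. length (Ls ! u))"
    unfolding visited_size_def by (rule sum_mono2) (auto simp: visited_def)
  also have "\<dots> = length (concat Ls)"
    by (simp add: length_concat sum_list_sum_nth atLeast0LessThan)
  finally show ?thesis .
qed

section \<open>Handling one edge\<close>

definition try_split :: "expr \<Rightarrow> com" where
  "try_split e = Seq (Assign ''x'' e)
    (Cond (Bin Mul
        (Bin Equal (Load ''UB'' (Bin Add (Reg ''Ub'') (Reg ''x''))) (Bin Add (Reg ''Un'') (Const 1)))
        (Bin Equal (Load ''VB'' (Bin Add (Reg ''Vb'') (Bin Sub (Reg ''m'') (Reg ''x''))))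
          (Bin Add (Reg ''Vn'') (Const 1))))
      (Assign ''y'' (Const 1)) Skip)"

definition try_splits :: "expr list \<Rightarrow> com" where
  "try_splits es = foldr (\<lambda>e. Seq (try_split e)) es Skip"

text \<open>Only the scratch registers \<open>x\<close> and \<open>y\<close> change between trials,
  so the evaluation hypothesis quantifies over them. The bound \<open>f e \<le> m\<close> keeps
  \<open>m - x\<close> exact and the cell indices below \<open>2 ^ w\<close>.\<close>

lemma wpt_try_splits:
  assumes w: "0 < w" and r: "reg s ''Un'' = u" "reg s ''Vn'' = v" "reg s ''Ub'' = bu" "reg s ''Vb'' = bv"
      "reg s ''m'' = m"
    and len: "bu + m < 2 ^ w" "bv + m < 2 ^ w" "Suc u < 2 ^ w" "Suc v < 2 ^ w"
    and es: "\<And>e a y. e \<in> set es \<Longrightarrow> eval_expr w (s\<lparr>reg := (reg s)(''x'' := a, ''y'' := y)\<rparr>) e = f e"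
      "\<And>e. e \<in> set es \<Longrightarrow> f e \<le> m" "\<And>e. e \<in> set es \<Longrightarrow> cost e \<le> 10"
    and ok: "\<And>i. i \<le> m \<Longrightarrow> ok i \<longleftrightarrow> mem s ''UB'' (bu + i) = Suc u \<and> mem s ''VB'' (bv + (m - i)) = Suc v"
  shows "wpt w (try_splits es) (\<lambda>t s'. t \<le> 60 * length es + 1 \<and>
      (\<exists>a. s' = s\<lparr>reg := (reg s)(''x'' := a, ''y'' := (if \<exists>e\<in>set es. ok (f e) then 1 else y))\<rparr>))
    (s\<lparr>reg := (reg s)(''x'' := a, ''y'' := y)\<rparr>)"
  using es
proof (induction es arbitrary: a y)
  case Nil
  then show ?case by (auto simp: try_splits_def)
next
  case (Cons e es)
  let ?S = "\<lambda>a y. s\<lparr>reg := (reg s)(''x'' := a, ''y'' := y)\<rparr>"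
  let ?y = "if ok (f e) then 1 else y"
  have fe: "eval_expr w (?S a y) e = f e" "f e \<le> m" "cost e \<le> 10" for a y
    by (rule Cons.prems; simp)+
  have "wpt w (try_split e) (\<lambda>t s'. t \<le> 60 \<and> s' = ?S (f e) ?y) (?S a y)"
    using w r len fe ok[OF fe(2)]
    by (auto simp: try_split_def eval_simps fun_upd_twist)
  then obtain t where t: "exec w (try_split e) (?S a y) t (?S (f e) ?y)" "t \<le> 60"
    by (auto simp: wpt_def)
  have "wpt w (try_splits es) (\<lambda>t s'. t \<le> 60 * length es + 1 \<and>
      (\<exists>a. s' = ?S a (if \<exists>e\<in>set es. ok (f e) then 1 else ?y))) (?S (f e) ?y)"
    by (rule Cons.IH; rule Cons.prems; simp)
  then obtain t' a' where t': "exec w (try_splits es) (?S (f e) ?y) t'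
      (?S a' (if \<exists>e\<in>set es. ok (f e) then 1 else ?y))" "t' \<le> 60 * length es + 1"
    by (auto simp: wpt_def)
  have eq: "(if \<exists>e\<in>set es. ok (f e) then 1 else ?y) = (if \<exists>e\<in>set (e # es). ok (f e) then 1 else y)"
    by auto
  have "try_splits (e # es) = Seq (try_split e) (try_splits es)" by (simp add: try_splits_def)
  then have "exec w (try_splits (e # es)) (?S a y) (t + t') (?S a' (if \<exists>e\<in>set (e # es). ok (f e) then 1 else y))"
    using exec.Seq[OF t(1) t'(1)] unfolding eq by simp
  then show ?case
    by (rule wptI) (intro conjI exI[of _ a'] refl, use t(2) t'(2) in simp)
qed

text \<open>The first three expressions are the members of \<open>cands P x z\<close>; the last
  three mirror \<open>cands (rev P) z x\<close> by subtraction from \<open>m\<close>.\<close>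

definition process_edge :: com where
  "process_edge =
    Seq (Assign ''Un'' (Load ''E_fst'' (Reg ''i'')))
    (Seq (Assign ''Vn'' (Load ''E_snd'' (Reg ''i'')))
    (Seq (visit (CHR ''U'') (CHR ''V'') True)
    (Seq (visit (CHR ''V'') (CHR ''U'') False)
    (Seq (Assign ''y'' (Const 0))
    (Seq (try_splits
      [Load ''UA'' (Reg ''Un''),
       Load ''UF'' (Load ''UA'' (Reg ''Un'')),
       Bin Sub (Reg ''Ue'') (Load ''VD'' (Reg ''Vn'')),
       Bin Sub (Reg ''m'') (Load ''VA'' (Reg ''Vn'')),
       Bin Sub (Reg ''m'') (Load ''VF'' (Load ''VA'' (Reg ''Vn''))),
       Bin Sub (Reg ''m'') (Bin Sub (Reg ''Ve'') (Load ''UD'' (Reg ''Un'')))])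
    (Cond (Reg ''y'')
      (Seq (Store ''out_fst'' (Reg ''out_count'') (Reg ''Un''))
      (Seq (Store ''out_snd'' (Reg ''out_count'') (Reg ''Vn''))
        (Assign ''out_count'' (Bin Add (Reg ''out_count'') (Const 1)))))
      Skip))))))"

lemma reported_pairs_snoc:
  assumes "mem s' ''out_fst'' = (mem s ''out_fst'')(reg s ''out_count'' := u)"
    "mem s' ''out_snd'' = (mem s ''out_snd'')(reg s ''out_count'' := v)"
    "reg s' ''out_count'' = Suc (reg s ''out_count'')"
  shows "reported_pairs s' = reported_pairs s @ [(u, v)]"
  using assms by (simp add: reported_pairs_def)

lemma stamp_iff_overlap:
  assumes "stamps_ok c fwd Ls P s" "u \<in> visited c Ls s"
  shows "mem s (c # ''B'') (offset Ls u + u + i) = Suc u \<longleftrightarrow> overlap P (orient fwd (Ls ! u)) i"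
  using assms by (auto simp: stamps_ok_def visited_def)

definition ready :: "nat list \<Rightarrow> nat list list \<Rightarrow> nat list list \<Rightarrow> (nat \<times> nat) list \<Rightarrow> state \<Rightarrow> bool" where
  "ready P Us Vs es s \<longleftrightarrow>
    loaded (CHR ''U'') Us P s \<and> loaded (CHR ''V'') Vs (rev P) s \<and>
    stamps_ok (CHR ''U'') True Us P s \<and> stamps_ok (CHR ''V'') False Vs (rev P) s \<and>
    reg s ''E_count'' = length es \<and>
    (\<forall>k < length es. mem s ''E_fst'' k = fst (es ! k) \<and> mem s ''E_snd'' k = snd (es ! k))"

definition potential :: "nat list list \<Rightarrow> nat list list \<Rightarrow> state \<Rightarrow> nat" where
  "potential Us Vs s = visited_size (CHR ''U'') Us s + visited_size (CHR ''V'') Vs s"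

text \<open>The 1000 absorbs two visits at 220, six trials at 60 and the output.
  \<open>out_count \<le> i\<close> keeps the output counter within a word.\<close>

lemma wpt_process_edge:
  assumes w: "0 < w"
    and len: "4 * (length P + length Us + length Vs + length (concat Us) + length (concat Vs) + length es + 1) \<le> 2 ^ w"
    and s: "ready P Us Vs es s" and i: "reg s ''i'' = i" "i < length es"
    and uv: "es ! i = (u, v)" "u < length Us" "v < length Vs"
    and out: "reg s ''out_count'' \<le> i"
    and Q: "\<And>t s'. t + 200 * potential Us Vs s \<le> 1000 + 200 * potential Us Vs s' \<Longrightarrow>
      ready P Us Vs es s' \<Longrightarrow> reg s' ''i'' = i \<Longrightarrow>
      reported_pairs s' = reported_pairs s @
        (if \<exists>i \<le> length P. split_at P (Us ! u) (rev (Vs ! v)) i then [(u, v)] else []) \<Longrightarrow> Q t s'"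
  shows "wpt w process_edge Q s"
proof -
  define x where "x = orient True (Us ! u)"
  define z where "z = orient False (Vs ! v)"
  have xz: "x = Us ! u" "z = rev (Vs ! v)" by (simp_all add: x_def z_def orient_def)
  have lU: "4 * (length P + length Us + length (concat Us) + 1) \<le> 2 ^ w"
    and lV: "4 * (length (rev P) + length Vs + length (concat Vs) + 1) \<le> 2 ^ w"
    by (rule order.trans[OF _ len], simp)+
  have big: "a < 2 ^ w" if "a \<le> length P + length Us + length Vs + length (concat Us) + length (concat Vs) + length es" for a
    using that by (intro less_le_trans[OF _ len]) simp
  let ?s0 = "s\<lparr>reg := (reg s)(''Un'' := u, ''Vn'' := v)\<rparr>"
  have l0: "loaded (CHR ''U'') Us P ?s0" "loaded (CHR ''V'') Vs (rev P) ?s0"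
    using s by (auto simp: ready_def elim!: loaded_cong)
  have st0: "stamps_ok (CHR ''U'') True Us P ?s0" "stamps_ok (CHR ''V'') False Vs (rev P) ?s0"
    using s by (auto simp: ready_def stamps_cong[where s = s and s' = ?s0])
  have pot0: "visited_size c Ls ?s0 = visited_size c Ls s" for c Ls
    by (rule stamps_cong) simp
  have "wpt w (visit (CHR ''U'') (CHR ''V'') True) (\<lambda>t s1.
      t + 200 * visited_size (CHR ''U'') Us s \<le> 220 + 200 * visited_size (CHR ''U'') Us s1 \<and>
      stamps_ok (CHR ''U'') True Us P s1 \<and> u \<in> visited (CHR ''U'') Us s1 \<and> reg s1 ''Ub'' = offset Us u + u \<and>
      (\<forall>a. a \<notin> {''UA'', ''UB'', ''UD''} \<longrightarrow> mem s1 a = mem ?s0 a) \<and>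
      (\<forall>y. y \<notin> {''j'', ''k'', ''o'', ''n'', ''r'', ''Ub''} \<longrightarrow> reg s1 y = reg ?s0 y)) ?s0"
    by (rule wpt_visit[OF w lU l0(1) _ st0(1) _ uv(2)]) (use l0(2) in \<open>simp_all add: loaded_def pot0\<close>)
  then obtain t1 s1 where e1: "exec w (visit (CHR ''U'') (CHR ''V'') True) ?s0 t1 s1"
    and 1: "t1 + 200 * visited_size (CHR ''U'') Us s \<le> 220 + 200 * visited_size (CHR ''U'') Us s1"
      "stamps_ok (CHR ''U'') True Us P s1" "u \<in> visited (CHR ''U'') Us s1" "reg s1 ''Ub'' = offset Us u + u"
      "\<forall>a. a \<notin> {''UA'', ''UB'', ''UD''} \<longrightarrow> mem s1 a = mem ?s0 a"
      "\<forall>y. y \<notin> {''j'', ''k'', ''o'', ''n'', ''r'', ''Ub''} \<longrightarrow> reg s1 y = reg ?s0 y"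
    by (elim wptE conjE) (rule that; assumption)
  have l1: "loaded (CHR ''U'') Us P s1" "loaded (CHR ''V'') Vs (rev P) s1"
    by (rule loaded_cong[OF l0(1)] loaded_cong[OF l0(2)]; simp add: 1(5,6))+
  have st1: "stamps_ok (CHR ''V'') False Vs (rev P) s1"
    "visited_size (CHR ''V'') Vs s1 = visited_size (CHR ''V'') Vs s"
    using st0(2) pot0 stamps_cong(2,3)[where s = ?s0 and s' = s1 and c = "CHR ''V''"]
    by (simp_all add: 1(5))
  have "wpt w (visit (CHR ''V'') (CHR ''U'') False) (\<lambda>t s2.
      t + 200 * visited_size (CHR ''V'') Vs s1 \<le> 220 + 200 * visited_size (CHR ''V'') Vs s2 \<and>
      stamps_ok (CHR ''V'') False Vs (rev P) s2 \<and> v \<in> visited (CHR ''V'') Vs s2 \<and> reg s2 ''Vb'' = offset Vs v + v \<and>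
      (\<forall>a. a \<notin> {''VA'', ''VB'', ''VD''} \<longrightarrow> mem s2 a = mem s1 a) \<and>
      (\<forall>y. y \<notin> {''j'', ''k'', ''o'', ''n'', ''r'', ''Vb''} \<longrightarrow> reg s2 y = reg s1 y)) s1"
    by (rule wpt_visit[OF w lV l1(2) _ st1(1) _ uv(3)]) (use l1(1) in \<open>simp_all add: loaded_def 1(6)\<close>)
  then obtain t2 s2 where e2: "exec w (visit (CHR ''V'') (CHR ''U'') False) s1 t2 s2"
    and 2: "t2 + 200 * visited_size (CHR ''V'') Vs s1 \<le> 220 + 200 * visited_size (CHR ''V'') Vs s2"
      "stamps_ok (CHR ''V'') False Vs (rev P) s2" "v \<in> visited (CHR ''V'') Vs s2" "reg s2 ''Vb'' = offset Vs v + v"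
      "\<forall>a. a \<notin> {''VA'', ''VB'', ''VD''} \<longrightarrow> mem s2 a = mem s1 a"
      "\<forall>y. y \<notin> {''j'', ''k'', ''o'', ''n'', ''r'', ''Vb''} \<longrightarrow> reg s2 y = reg s1 y"
    by (elim wptE conjE) (rule that; assumption)
  have l2: "loaded (CHR ''U'') Us P s2" "loaded (CHR ''V'') Vs (rev P) s2"
    by (rule loaded_cong[OF l1(1)] loaded_cong[OF l1(2)]; simp add: 2(5,6))+
  have U2: "stamps_ok (CHR ''U'') True Us P s2" "u \<in> visited (CHR ''U'') Us s2"
    "visited_size (CHR ''U'') Us s2 = visited_size (CHR ''U'') Us s1"
    using 1(2,3) stamps_cong[where s = s1 and s' = s2 and c = "CHR ''U''"]
    by (simp_all add: 2(5))
  have r2: "reg s2 ''Un'' = u" "reg s2 ''Vn'' = v" "reg s2 ''Ub'' = offset Us u + u" "reg s2 ''Vb'' = offset Vs v + v"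
    "reg s2 ''i'' = i" "reg s2 ''m'' = length P" "reg s2 ''out_count'' = reg s ''out_count''"
    "reg s2 ''E_count'' = reg s ''E_count''" "reg s2 ''Ue'' = period_end (half_period P) P"
    "reg s2 ''Ve'' = period_end (half_period (rev P)) (rev P)"
    using 1(4) 2(4) i l2 by (simp_all add: loaded_def 1(6) 2(6))
  have m2: "mem s2 a = mem s a" if "a \<in> {''out_fst'', ''out_snd'', ''E_fst'', ''E_snd''}" for a
    using that by (auto simp: 1(5) 2(5))
  have AD: "mem s2 ''UA'' u = max_overlap P x" "mem s2 ''UD'' u = period_end (half_period (rev P)) (rev x)"
    "mem s2 ''VA'' v = max_overlap (rev P) z" "mem s2 ''VD'' v = period_end (half_period P) (rev z)"
    using U2 2(2,3) by (auto simp: stamps_ok_def x_def z_def)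
  have F2: "mem s2 ''UF'' (max_overlap P x) = fail P (max_overlap P x)" "mem s2 ''VF'' (max_overlap (rev P) z) = fail (rev P) (max_overlap (rev P) z)"
    using l2 max_overlap_le(1)[of P x] max_overlap_le(1)[of "rev P" z] by (auto simp: loaded_def)
  have bU: "offset Us u + u + length P \<le> length P + length Us + length (concat Us)"
    and bV: "offset Vs v + v + length P \<le> length P + length Vs + length (concat Vs)"
    using offset_le[of Us u] offset_le[of Vs v] uv(2,3) by auto
  let ?es = "[Load ''UA'' (Reg ''Un''),
       Load ''UF'' (Load ''UA'' (Reg ''Un'')),
       Bin Sub (Reg ''Ue'') (Load ''VD'' (Reg ''Vn'')),
       Bin Sub (Reg ''m'') (Load ''VA'' (Reg ''Vn'')),
       Bin Sub (Reg ''m'') (Load ''VF'' (Load ''VA'' (Reg ''Vn''))),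
       Bin Sub (Reg ''m'') (Bin Sub (Reg ''Ve'') (Load ''UD'' (Reg ''Un'')))]"
  let ?f = "eval_expr w s2"
  have eU: "period_end (half_period P) P \<le> length P" "period_end (half_period (rev P)) (rev P) \<le> length P"
    using period_end_half_period_le[of P] period_end_half_period_le[of "rev P"] by auto
  have pw: "length P < 2 ^ w" by (rule big) simp
  have ev: "map ?f ?es = [max_overlap P x, fail P (max_overlap P x), period_end (half_period P) P - period_end (half_period P) (rev z),
      length P - max_overlap (rev P) z, length P - fail (rev P) (max_overlap (rev P) z),
      length P - (period_end (half_period (rev P)) (rev P) - period_end (half_period (rev P)) (rev x))]"
    using w r2 AD F2 le_less_trans[OF eU(1) pw] le_less_trans[OF eU(2) pw] pw
    by (simp add: eval_simps)
  have W: "wpt w (try_splits ?es) (\<lambda>t s'. t \<le> 60 * length ?es + 1 \<and>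
      (\<exists>a. s' = s2\<lparr>reg := (reg s2)(''x'' := a, ''y'' := (if \<exists>e\<in>set ?es. split_at P x z (?f e) then 1 else 0))\<rparr>))
    (s2\<lparr>reg := (reg s2)(''x'' := reg s2 ''x'', ''y'' := 0)\<rparr>)"
  proof (rule wpt_try_splits[OF w r2(1-4,6)])
    show "offset Us u + u + length P < 2 ^ w" "offset Vs v + v + length P < 2 ^ w" "Suc u < 2 ^ w" "Suc v < 2 ^ w"
      using bU bV uv(2,3) by (auto intro!: big)
    show "eval_expr w (s2\<lparr>reg := (reg s2)(''x'' := a, ''y'' := y)\<rparr>) e = ?f e" if "e \<in> set ?es" for e a y
      using that by (auto simp: eval_expr.simps(4))
    have "fail P (max_overlap P x) \<le> length P" by (rule cands_le[of _ P x z]) (simp add: cands_def)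
    then have sub: "set (map ?f ?es) \<subseteq> {..length P}"
      unfolding ev using eU(1) max_overlap_le(1)[of P x] by simp
    show "?f e \<le> length P" if "e \<in> set ?es" for e
    proof -
      have "?f e \<in> set (map ?f ?es)" using that unfolding set_map by (rule imageI)
      then have "?f e \<in> {..length P}" by (rule subsetD[OF sub])
      then show ?thesis by (simp only: atMost_iff)
    qed
    show "cost e \<le> 10" if "e \<in> set ?es" for e using that by auto
    show "split_at P x z i \<longleftrightarrow> mem s2 ''UB'' (offset Us u + u + i) = Suc u \<and>
        mem s2 ''VB'' (offset Vs v + v + (length P - i)) = Suc v" for i
      using stamp_iff_overlap[OF U2(1,2)] stamp_iff_overlap[OF 2(2,3)] by (simp add: split_at_def x_def z_def)
  qed
  \<comment> \<open>The tested values are the candidates of both orientations, so they decide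
    whether any split exists.\<close>
  have ex: "(\<exists>e\<in>set ?es. split_at P x z (?f e)) \<longleftrightarrow> (\<exists>i \<le> length P. split_at P x z i)"
  proof -
    have "(\<exists>e\<in>set ?es. split_at P x z (?f e)) \<longleftrightarrow> (\<exists>i\<in>set (map ?f ?es). split_at P x z i)"
      unfolding set_map by blast
    also have "\<dots> \<longleftrightarrow> (\<exists>i \<le> length P. split_at P x z i)"
      unfolding ev split_at_iff_cands[of P x z] by (auto simp: cands_def)
    finally show ?thesis .
  qed
  have x0: "(reg s2)(''x'' := reg s2 ''x'', ''y'' := 0) = (reg s2)(''y'' := 0)" by simp
  from W[unfolded ex x0] obtain t3 a where e3: "exec w (try_splits ?es) (s2\<lparr>reg := (reg s2)(''y'' := 0)\<rparr>) t3
      (s2\<lparr>reg := (reg s2)(''x'' := a, ''y'' := (if \<exists>i \<le> length P. split_at P x z i then 1 else 0))\<rparr>)"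
    and t3: "t3 \<le> 361"
    by (elim wptE conjE exE, hypsubst) (rule that, assumption, simp)
  have oc: "Suc (reg s ''out_count'') < 2 ^ w" by (rule big) (use out i in simp)
  have ready: "ready P Us Vs es s'"
    if "\<And>a. a \<notin> {''out_fst'', ''out_snd''} \<Longrightarrow> mem s' a = mem s2 a"
      "\<And>y. y \<notin> {''x'', ''y'', ''out_count''} \<Longrightarrow> reg s' y = reg s2 y" for s'
    unfolding ready_def
  proof (intro conjI)
    show "loaded (CHR ''U'') Us P s'" by (rule loaded_cong[OF l2(1)]) (simp add: that)+
    show "loaded (CHR ''V'') Vs (rev P) s'" by (rule loaded_cong[OF l2(2)]) (simp add: that)+
    show "stamps_ok (CHR ''U'') True Us P s'"
      using U2(1) stamps_cong(3)[where s = s2 and s' = s' and c = "CHR ''U''"] by (simp add: that)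
    show "stamps_ok (CHR ''V'') False Vs (rev P) s'"
      using 2(2) stamps_cong(3)[where s = s2 and s' = s' and c = "CHR ''V''"] by (simp add: that)
    show "reg s' ''E_count'' = length es" using s by (simp add: that r2(8) ready_def)
    show "\<forall>k<length es. mem s' ''E_fst'' k = fst (es ! k) \<and> mem s' ''E_snd'' k = snd (es ! k)"
      using s by (simp add: that m2 ready_def)
  qed
  have pot: "potential Us Vs s' = visited_size (CHR ''U'') Us s1 + visited_size (CHR ''V'') Vs s2"
    if "\<And>a. a \<notin> {''out_fst'', ''out_snd''} \<Longrightarrow> mem s' a = mem s2 a" for s'
    using U2(3) by (simp add: potential_def stamps_cong(2)[where s = s2 and s' = s'] that)
  have pot_s: "potential Us Vs s = visited_size (CHR ''U'') Us s + visited_size (CHR ''V'') Vs s1"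
    by (simp add: potential_def st1)
  let ?y = "if \<exists>i \<le> length P. split_at P x z i then 1 else 0 :: nat"
  let ?s3 = "s2\<lparr>reg := (reg s2)(''x'' := a, ''y'' := ?y)\<rparr>"
  have E: "mem s ''E_fst'' (reg s ''i'') = u" "mem s ''E_snd'' (reg s ''i'') = v"
    using s i uv by (auto simp: ready_def)
  have unfold: "wpt w process_edge Q s \<longleftrightarrow> wpt w (Cond (Reg ''y'')
      (Seq (Store ''out_fst'' (Reg ''out_count'') (Reg ''Un''))
      (Seq (Store ''out_snd'' (Reg ''out_count'') (Reg ''Vn''))
        (Assign ''out_count'' (Bin Add (Reg ''out_count'') (Const 1)))))
      Skip) (\<lambda>t. Q (3 + (3 + (t1 + (t2 + (2 + (t3 + t))))))) ?s3"
    unfolding process_edge_def wpt_Seq wpt_Assign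
    by (simp add: E wpt_exec[OF e1] wpt_exec[OF e2] wpt_exec[OF e3] numeral_eq_Suc del: wpt_Cond)
  show ?thesis
  proof (cases "\<exists>i \<le> length P. split_at P x z i")
    case True
    then have y: "?y = 1" by (rule if_P)
    let ?s4 = "s2\<lparr>mem := (mem s2)(''out_fst'' := (mem s2 ''out_fst'')(reg s ''out_count'' := u),
        ''out_snd'' := (mem s2 ''out_snd'')(reg s ''out_count'' := v)),
      reg := (reg s2)(''x'' := a, ''y'' := 1, ''out_count'' := Suc (reg s ''out_count''))\<rparr>"
    have "Q (3 + (3 + (t1 + (t2 + (2 + (t3 + 12)))))) ?s4"
    proof (rule Q)
      show "3 + (3 + (t1 + (t2 + (2 + (t3 + 12))))) + 200 * potential Us Vs s \<le> 1000 + 200 * potential Us Vs ?s4"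
        using pot[of ?s4] 1(1) 2(1) t3 by (simp add: pot_s)
      show "ready P Us Vs es ?s4" by (rule ready) auto
      show "reg ?s4 ''i'' = i" using r2 by simp
      have "reported_pairs ?s4 = reported_pairs s @ [(u, v)]"
        by (rule reported_pairs_snoc) (use m2 in auto)
      then show "reported_pairs ?s4 = reported_pairs s @
        (if \<exists>i\<le>length P. split_at P (Us ! u) (rev (Vs ! v)) i then [(u, v)] else [])"
        using True by (simp add: xz)
    qed
    then show ?thesis
      unfolding unfold y using r2 oc w by (simp add: eval_simps)
  next
    case False
    then have y: "?y = 0" by (rule if_not_P)
    let ?s4 = "s2\<lparr>reg := (reg s2)(''x'' := a, ''y'' := 0)\<rparr>"
    have "Q (3 + (3 + (t1 + (t2 + (2 + (t3 + 3)))))) ?s4"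
    proof (rule Q)
      show "3 + (3 + (t1 + (t2 + (2 + (t3 + 3))))) + 200 * potential Us Vs s \<le> 1000 + 200 * potential Us Vs ?s4"
        using pot[of ?s4] 1(1) 2(1) t3 by (simp add: pot_s)
      show "ready P Us Vs es ?s4" by (rule ready) auto
      show "reg ?s4 ''i'' = i" using r2 by simp
      have "reported_pairs ?s4 = reported_pairs s"
        using r2 m2 by (simp add: reported_pairs_def)
      then show "reported_pairs ?s4 = reported_pairs s @
        (if \<exists>i\<le>length P. split_at P (Us ! u) (rev (Vs ! v)) i then [(u, v)] else [])"
        using False by (simp add: xz)
    qed
    then show ?thesis
      unfolding unfold y by simp
  qed
qed

section \<open>The loop over the edges\<close>

definition query :: com where
  "query = Seq (Assign ''out_count'' (Const 0)) (Seq (Assign ''i'' (Const 0))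
    (While (Bin Less (Reg ''i'') (Reg ''E_count''))
      (Seq process_edge (Assign ''i'' (Bin Add (Reg ''i'') (Const 1))))))"

lemma ready_set_reg:
  "ready P Us Vs es s \<Longrightarrow> r \<in> {''i'', ''out_count''} \<Longrightarrow>
    ready P Us Vs es (s\<lparr>reg := (reg s)(r := n)\<rparr>)"
  unfolding ready_def
  by (intro conjI; elim conjE; (erule loaded_cong)?)
    (auto simp: stamps_cong[where s' = "s\<lparr>reg := (reg s)(r := n)\<rparr>" and s = s])

lemma wpt_query:
  fixes P :: "nat list"
  defines "match \<equiv> \<lambda>Us Vs (u, v). \<exists>i \<le> length P. split_at P (Us ! u) (rev (Vs ! v)) i"
  assumes w: "0 < w"
    and len: "4 * (length P + length Us + length Vs + length (concat Us) + length (concat Vs) + length es + 1) \<le> 2 ^ w"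
    and s: "ready P Us Vs es s" and es: "set es \<subseteq> {..<length Us} \<times> {..<length Vs}"
  shows "wpt w query (\<lambda>t s'. t \<le> 1200 * length es + 200 * (length (concat Us) + length (concat Vs)) + 20 \<and>
    reported_pairs s' = filter (match Us Vs) es) s"
proof -
  let ?B = "1200 * length es + 200 * (length (concat Us) + length (concat Vs))"
  \<comment> \<open>The 1200 per edge is the 1000 of \<open>wpt_process_edge\<close> with slack for
    the loop; the potential accounts for the visits and is capped by
    \<open>visited_size_le\<close>.\<close>
  let ?I = "\<lambda>t s'. \<exists>i \<le> length es. reg s' ''i'' = i \<and> ready P Us Vs es s' \<and>
    reported_pairs s' = filter (match Us Vs) (take i es) \<and> t \<le> 1200 * i + 200 * potential Us Vs s'"
  have leB: "t \<le> ?B" if "?I t s'" for t s'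
  proof -
    from that obtain i where "i \<le> length es" "t \<le> 1200 * i + 200 * potential Us Vs s'"
      by (elim exE conjE) (rule that; assumption)
    then show ?thesis
      using visited_size_le[of "CHR ''U''" Us s'] visited_size_le[of "CHR ''V''" Vs s']
      by (simp add: potential_def)
  qed
  have "length es + 1 < 4 * (length P + length Us + length Vs + length (concat Us) + length (concat Vs) + length es + 1)"
    by simp
  then have les: "length es + 1 < 2 ^ w" using len by (rule less_le_trans)
  have c0: "eval_expr w s' (Const 0) = 0" for s' by simp
  let ?s0 = "s\<lparr>reg := (reg s)(''out_count'' := 0)\<rparr>"
  let ?s1 = "?s0\<lparr>reg := (reg ?s0)(''i'' := 0)\<rparr>"
  show ?thesis
    unfolding query_def wpt_Seq wpt_Assign c0
  proof (rule wpt_While[where I = ?I and B = ?B])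
    show "?I 0 ?s1"
    proof (intro exI[of _ 0] conjI)
      show "ready P Us Vs es ?s1" by (intro ready_set_reg s) auto
    qed (auto simp: reported_pairs_def)
  next
    fix t s'
    assume "?I t s'" and b: "eval_expr w s' (Bin Less (Reg ''i'') (Reg ''E_count'')) \<noteq> 0"
    then obtain i where i: "reg s' ''i'' = i" "ready P Us Vs es s'"
      "reported_pairs s' = filter (match Us Vs) (take i es)" "t \<le> 1200 * i + 200 * potential Us Vs s'"
      by (elim exE conjE) (rule that; assumption)
    have "reg s' ''E_count'' = length es" using i(2) by (simp add: ready_def)
    then have il: "i < length es" using b i(1) w by (simp add: eval_simps split: if_splits)
    obtain u v where uv: "es ! i = (u, v)" by fastforce
    have "es ! i \<in> set es" using il by simp
    then have uvl: "u < length Us" "v < length Vs" using es uv by auto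
    \<comment> \<open>At most one pair is reported per edge, which bounds the output
      counter.\<close>
    have "length (reported_pairs s') \<le> i"
      unfolding i(3) using length_filter_le[of "match Us Vs" "take i es"] il by simp
    then have oc: "reg s' ''out_count'' \<le> i" by (simp add: reported_pairs_def)
    show "wpt w (Seq process_edge (Assign ''i'' (Bin Add (Reg ''i'') (Const 1))))
      (\<lambda>t' s''. ?I (t + (1 + cost (Bin Less (Reg ''i'') (Reg ''E_count''))) + t') s'') s'"
      unfolding wpt_Seq wpt_Assign
    proof (rule wpt_process_edge[OF w len i(2,1) il uv uvl oc])
      fix t2 s2
      assume 2: "t2 + 200 * potential Us Vs s' \<le> 1000 + 200 * potential Us Vs s2"
        "ready P Us Vs es s2" "reg s2 ''i'' = i"
        "reported_pairs s2 = reported_pairs s' @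
          (if \<exists>i\<le>length P. split_at P (Us ! u) (rev (Vs ! v)) i then [(u, v)] else [])"
      have ev: "eval_expr w s2 (Bin Add (Reg ''i'') (Const 1)) = Suc i"
        using 2(3) il les w by (simp add: eval_simps)
      let ?s3 = "s2\<lparr>reg := (reg s2)(''i'' := Suc i)\<rparr>"
      have "potential Us Vs ?s3 = potential Us Vs s2"
        by (simp add: potential_def stamps_cong(2)[where s = s2 and s' = ?s3])
      moreover have "reported_pairs ?s3 = filter (match Us Vs) (take (Suc i) es)"
        using 2(4) i(3) il uv by (simp add: reported_pairs_def match_def take_Suc_conv_app_nth)
      moreover have "ready P Us Vs es ?s3" using 2(2) by (rule ready_set_reg) simp
      ultimately show "?I (t + (1 + cost (Bin Less (Reg ''i'') (Reg ''E_count''))) +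
          (t2 + (1 + cost (Bin Add (Reg ''i'') (Const 1)))))
        (s2\<lparr>reg := (reg s2)(''i'' := eval_expr w s2 (Bin Add (Reg ''i'') (Const 1)))\<rparr>)"
        unfolding ev using il i(4) 2(1) by (intro exI[of _ "Suc i"]) simp
    qed
  next
    fix t s'
    assume I: "?I t s'" and b: "eval_expr w s' (Bin Less (Reg ''i'') (Reg ''E_count'')) = 0"
    then obtain i where i: "i \<le> length es" "reg s' ''i'' = i" "ready P Us Vs es s'"
      "reported_pairs s' = filter (match Us Vs) (take i es)"
      by (elim exE conjE) (rule that; assumption)
    have "reg s' ''E_count'' = length es" using i(3) by (simp add: ready_def)
    then have "i = length es" using b i(1,2) w by (simp add: eval_simps split: if_splits)
    then show "1 + cost (Const 0) + (1 + cost (Const 0) + (t + (1 + cost (Bin Less (Reg ''i'') (Reg ''E_count''))))) \<le> ?B + 20 \<and>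
      reported_pairs s' = filter (match Us Vs) es"
      using leB[OF I] i(4) by simp
  qed (rule leB)
qed

section \<open>Preprocessing both orientations, and loading a graph\<close>

definition prep :: com where
  "prep = Seq (prepare (CHR ''U'') (Load ''P'' (Reg ''k'')))
    (prepare (CHR ''V'') (Load ''P'' (Bin Sub (Reg ''m'') (Bin Add (Reg ''k'') (Const 1)))))"

text \<open>\<open>B\<close> is to be blank: stamps are positive, so no node counts as visited when
  a graph arrives.\<close>

definition prepared :: "char \<Rightarrow> nat list \<Rightarrow> state \<Rightarrow> bool" where
  "prepared c P s \<longleftrightarrow> reg s ''m'' = length P \<and>
    reg s (c # ''q'') = half_period P \<and> reg s (c # ''e'') = period_end (half_period P) P \<and>
    (\<forall>i < length P. mem s (c # ''P'') i = P ! i) \<and> (\<forall>i \<le> length P. mem s (c # ''F'') i = fail P i) \<and>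
    mem s (c # ''B'') = (\<lambda>_. 0)"

lemma wpt_prep:
  assumes w: "0 < w" and len: "4 * (length P + 1) \<le> 2 ^ w"
  shows "wpt w prep (\<lambda>t s. t \<le> 600 * length P + 400 \<and>
    prepared (CHR ''U'') P s \<and> prepared (CHR ''V'') (rev P) s) (load_pattern P init_state)"
proof -
  let ?s = "load_pattern P init_state"
  have s: "reg ?s ''m'' = length P" "\<And>i. i < length P \<Longrightarrow> mem ?s ''P'' i = P ! i"
    "\<And>a. a \<noteq> ''P'' \<Longrightarrow> mem ?s a = (\<lambda>_. 0)"
    by (auto simp: load_pattern_def init_state_def set_reg_def set_array_def)
  have len': "4 * (length (rev P) + 1) \<le> 2 ^ w" "length P < 2 ^ w" "Suc (length P) < 2 ^ w" using len by auto
  have "wpt w (prepare (CHR ''U'') (Load ''P'' (Reg ''k''))) (\<lambda>t s'. t \<le> 300 * length P + 200 \<and>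
      prepared (CHR ''U'') P s' \<and>
      (\<forall>a. a \<notin> {''UP'', ''UF''} \<longrightarrow> mem s' a = mem ?s a) \<and> reg s' ''m'' = length P) ?s"
    by (rule wpt_prepare[where P = P, OF w s(1) len]) (use s in \<open>auto simp: prepared_def\<close>)
  then obtain t1 s1 where e1: "exec w (prepare (CHR ''U'') (Load ''P'' (Reg ''k''))) ?s t1 s1"
    and 1: "t1 \<le> 300 * length P + 200" "prepared (CHR ''U'') P s1"
      "\<forall>a. a \<notin> {''UP'', ''UF''} \<longrightarrow> mem s1 a = mem ?s a" "reg s1 ''m'' = length P"
    by (elim wptE conjE) (rule that; assumption)
  have "wpt w (prepare (CHR ''V'') (Load ''P'' (Bin Sub (Reg ''m'') (Bin Add (Reg ''k'') (Const 1)))))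
    (\<lambda>t s'. t \<le> 300 * length P + 200 \<and> prepared (CHR ''U'') P s' \<and> prepared (CHR ''V'') (rev P) s') s1"
    by (rule wpt_prepare[where P = "rev P", OF w _ len'(1)])
      (use 1(2,4) len' w s in \<open>auto simp: prepared_def eval_simps rev_nth 1(3)\<close>)
  then obtain t2 s2 where 2: "exec w (prepare (CHR ''V'') (Load ''P'' (Bin Sub (Reg ''m'') (Bin Add (Reg ''k'') (Const 1))))) s1 t2 s2"
    "t2 \<le> 300 * length P + 200" "prepared (CHR ''U'') P s2" "prepared (CHR ''V'') (rev P) s2"
    by (elim wptE conjE) (rule that; assumption)
  show ?thesis
    unfolding prep_def by (rule wptI[OF exec.Seq[OF e1 2(1)]]) (use 1(1) 2 in simp)
qed

lemma nth_offsets: "u \<le> length xss \<Longrightarrow> u < length (offsets xss) \<and> offsets xss ! u = offset xss u"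
  by (auto simp: offsets_def offset_def nth_append simp del: upt_Suc)

text \<open>Loading writes only the registers and arrays of the graph, so the pattern tables
  survive; blank stamps satisfy \<open>stamps_ok\<close> with no node visited.\<close>

lemma ready_load_graph:
  assumes "prepared (CHR ''U'') P s" "prepared (CHR ''V'') (rev P) s"
  shows "ready P (U_labels G) (V_labels G) es (load_graph G es s)"
proof -
  let ?s = "load_graph G es s"
  have reg: "reg ?s y = reg s y" if "y \<notin> {''U_count'', ''V_count'', ''E_count''}" for y
    using that by (simp add: load_graph_def set_reg_def set_array_def)
  have mem: "mem ?s a = mem s a" if "a \<notin> {''U_text'', ''U_offset'', ''V_text'', ''V_offset'', ''E_fst'', ''E_snd''}" for a
    using that by (simp add: load_graph_def set_reg_def set_array_def)
  have g: "reg ?s ''E_count'' = length es"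
    "i < length es \<Longrightarrow> mem ?s ''E_fst'' i = fst (es ! i) \<and> mem ?s ''E_snd'' i = snd (es ! i)"
    "i < length (concat (U_labels G)) \<Longrightarrow> mem ?s ''U_text'' i = concat (U_labels G) ! i"
    "i < length (concat (V_labels G)) \<Longrightarrow> mem ?s ''V_text'' i = concat (V_labels G) ! i"
    "i \<le> length (U_labels G) \<Longrightarrow> mem ?s ''U_offset'' i = offset (U_labels G) i"
    "i \<le> length (V_labels G) \<Longrightarrow> mem ?s ''V_offset'' i = offset (V_labels G) i" for i
    using nth_offsets[of i "U_labels G"] nth_offsets[of i "V_labels G"]
    by (simp_all add: load_graph_def set_reg_def set_array_def)
  have "loaded (CHR ''U'') (U_labels G) P ?s" "loaded (CHR ''V'') (V_labels G) (rev P) ?s"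
    using assms reg mem g by (simp_all add: loaded_def prepared_def)
  moreover have "stamps_ok (CHR ''U'') True (U_labels G) P ?s" "stamps_ok (CHR ''V'') False (V_labels G) (rev P) ?s"
    using assms mem by (simp_all add: stamps_ok_def visited_def prepared_def)
  ultimately show ?thesis using g by (simp add: ready_def)
qed

theorem theorem2:
  fixes p :: "nat poly"
  shows "\<exists>(prep :: com) (query :: com) (c :: nat) (T\<^sub>p :: nat \<Rightarrow> nat) (T\<^sub>q :: nat \<Rightarrow> nat).
    (\<lambda>n. real (T\<^sub>p n)) \<in> O(\<lambda>n. real n) \<and>
    (\<lambda>n. real (T\<^sub>q n)) \<in> O(\<lambda>n. real n) \<and>
    (\<forall>(w :: nat) (\<sigma> :: nat) (P :: nat list).
      set P \<subseteq> {..<\<sigma>} \<and> \<sigma> \<le> 2 ^ w \<and> c * (length P + 1) \<le> 2 ^ w \<longrightarrow>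
      (\<exists>t s. exec w prep (load_pattern P init_state) t s \<and> t \<le> T\<^sub>p (length P) \<and>
        (\<forall>(G :: bigraph) es.
          wf_bigraph G \<and> set es = edges G \<and> distinct es \<and>
          letters G \<subseteq> {..<\<sigma>} \<and> \<sigma> \<le> poly p (label_size G) \<and>
          c * (instance_size P G + 1) \<le> 2 ^ w \<longrightarrow>
          (\<exists>t' s'. exec w query (load_graph G es s) t' s' \<and>
             t' \<le> T\<^sub>q (label_size G + card (edges G)) \<and>
             distinct (reported_pairs s') \<and> set (reported_pairs s') = matching_pairs P G))))"
proof -
  have linear: "(\<lambda>n. real (a * n + b)) \<in> O(\<lambda>n. real n)" for a b :: nat
  proof (rule bigoI[where c = "real (a + b)"], rule eventually_sequentiallyI[of 1])
    fix n :: nat assume "1 \<le> n"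
    then have "a * n + b \<le> (a + b) * n" by (simp add: algebra_simps)
    then have "real (a * n + b) \<le> real ((a + b) * n)" by (rule of_nat_mono)
    then show "norm (real (a * n + b)) \<le> real (a + b) * norm (real n)" by simp
  qed
  have "(\<exists>t s. exec w prep (load_pattern P init_state) t s \<and> t \<le> 600 * length P + 400 \<and>
      (\<forall>G es. wf_bigraph G \<and> set es = edges G \<and> distinct es \<and> letters G \<subseteq> {..<\<sigma>} \<and>
        \<sigma> \<le> poly p (label_size G) \<and> 4 * (instance_size P G + 1) \<le> 2 ^ w \<longrightarrow>
        (\<exists>t' s'. exec w query (load_graph G es s) t' s' \<and>
          t' \<le> 1200 * (label_size G + card (edges G)) + 20 \<and>
          distinct (reported_pairs s') \<and> set (reported_pairs s') = matching_pairs P G)))"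
    if P: "4 * (length P + 1) \<le> 2 ^ w" for w \<sigma> :: nat and P :: "nat list"
  proof -
    \<comment> \<open>\<open>4 \<le> 2 ^ w\<close> excludes \<open>w = 0\<close>.\<close>
    have w: "0 < w" using P by (cases w) auto
    from wpt_prep[OF w P] obtain t s where prep: "exec w prep (load_pattern P init_state) t s"
      "t \<le> 600 * length P + 400" "prepared (CHR ''U'') P s" "prepared (CHR ''V'') (rev P) s"
      by (elim wptE conjE) (rule that; assumption)
    show ?thesis
    proof (rule exI[of _ t], rule exI[of _ s], intro conjI allI impI prep)
      fix G :: bigraph and es
      assume "wf_bigraph G \<and> set es = edges G \<and> distinct es \<and> letters G \<subseteq> {..<\<sigma>} \<and>
        \<sigma> \<le> poly p (label_size G) \<and> 4 * (instance_size P G + 1) \<le> 2 ^ w"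
      then have G: "set es \<subseteq> {..<length (U_labels G)} \<times> {..<length (V_labels G)}" "set es = edges G"
        "distinct es" "4 * (instance_size P G + 1) \<le> 2 ^ w"
        by (auto simp: wf_bigraph_def)
      have card: "card (edges G) = length es" using G(2,3) distinct_card by metis
      have size: "length (concat (U_labels G)) + length (concat (V_labels G)) = label_size G"
        by (simp add: label_size_def N_U_def N_V_def length_concat)
      have "instance_size P G = length P + length (U_labels G) + length (V_labels G) +
          length (concat (U_labels G)) + length (concat (V_labels G)) + length es"
        using size by (simp add: instance_size_def card)
      then have len: "4 * (length P + length (U_labels G) + length (V_labels G) +
          length (concat (U_labels G)) + length (concat (V_labels G)) + length es + 1) \<le> 2 ^ w"
        using G(4) by simp
      let ?match = "\<lambda>(u, v). \<exists>i \<le> length P. split_at P (U_labels G ! u) (rev (V_labels G ! v)) i"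
      from wpt_query[OF w len ready_load_graph[OF prep(3,4)] G(1)] obtain t' s'
        where query: "exec w query (load_graph G es s) t' s'"
          "t' \<le> 1200 * length es + 200 * (length (concat (U_labels G)) + length (concat (V_labels G))) + 20"
          "reported_pairs s' = filter ?match es"
        by (elim wptE conjE) (rule that; assumption)
      have "t' \<le> 1200 * (label_size G + card (edges G)) + 20"
        using query(2) by (simp add: size card)
      moreover have "set (reported_pairs s') = matching_pairs P G"
        unfolding query(3) matching_pairs_def split_at_iff_append by (auto simp: G(2))
      moreover have "distinct (reported_pairs s')" using G(3) by (simp add: query(3))
      ultimately show "\<exists>t' s'. exec w query (load_graph G es s) t' s' \<and>
          t' \<le> 1200 * (label_size G + card (edges G)) + 20 \<and>
          distinct (reported_pairs s') \<and> set (reported_pairs s') = matching_pairs P G"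
        using query(1) by blast
    qed
  qed
  note main = this
  show ?thesis
    by (rule exI[of _ prep], rule exI[of _ query], rule exI[of _ 4], rule exI[of _ "\<lambda>n. 600 * n + 400"],
        rule exI[of _ "\<lambda>n. 1200 * n + 20"], intro conjI linear allI impI, elim conjE, rule main)
qed

end
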